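(* Fix $1<p<\infty$ and an integer $n\ge 2$, and let $\mathbb B_p^n=\{x\in\mathbb R^n: |x_1|^p+\cdots+|x_n|^p\le 1\}$. Then for all $j\in\{0,\dots,n-1\}$ the $j$-th intrinsic volume of $\mathbb B_p^n$ is $$ V_j(\mathbb B_p^n)=\frac{p\,(p-1)^{n-j-1}\binom{n}{j}}{\kappa_{n-j}\,\Gamma(1+\frac jp)\,\Gamma(\frac{n-j}{2})}\int_0^\infty \theta^{\frac{n-j}{2}-1}\,\mathcal I_p(\theta)^j\,\mathcal J_p(\theta)^{n-j-1}\,\mathcal K_p(\theta)\,d\theta, $$ where, for $\theta\ge 0$, $$ \mathcal I_p(\theta)=\int_{\mathbb R}e^{-|x|^p-\theta|x|^{2p-2}}\,dx,\qquad \mathcal J_p(\theta)=\int_{\mathbb R}|x|^{p-2}e^{-|x|^p-\theta|x|^{2p-2}}\,dx, $$ $$ \mathcal K_p(\theta)=\int_{\mathbb R}|x|^{2p-2}e^{-|x|^p-\theta|x|^{2p-2}}\,dx=-\mathcal I_p'(\theta). $$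
   Context: For a convex body $K\subset\mathbb R^n$ (compact convex set with non-empty interior), the intrinsic volumes $V_0(K),\dots,V_n(K)$ are defined by the Steiner formula $\mathrm{Vol}_n(K+t\mathbb B_2^n)=\sum_{j=0}^n\kappa_{n-j}V_j(K)t^{n-j}$ for all $t\ge 0$, where $\mathbb B_2^n$ is the Euclidean unit ball, $\mathrm{Vol}_n$ is Lebesgue measure, and $\kappa_m=\mathrm{Vol}_m(\mathbb B_2^m)=\pi^{m/2}/\Gamma(1+\frac m2)$. *)

theory Defs
  imports "HOL-Analysis.Analysis"
begin

definition steiner_coeffs :: "'a::euclidean_space set \<Rightarrow> (nat \<Rightarrow> real) \<Rightarrow> bool" where
  "steiner_coeffs K V \<longleftrightarrow>
     (\<forall>t\<ge>0. measure lebesgue {x + t *\<^sub>R u | x u. x \<in> K \<and> u \<in> cball 0 1} =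
        (\<Sum>j\<le>DIM('a). unit_ball_vol (real (DIM('a) - j)) * V j * t ^ (DIM('a) - j)))"

text \<open>
  The definite description is meaningful only for \<open>j \<le> DIM('a)\<close> and for sets \<open>K\<close> that have
  a Steiner polynomial, which includes all convex bodies. Uniqueness is
  \<open>steiner_coeffs_unique\<close> below.
\<close>

definition intrinsic_volume :: "nat \<Rightarrow> 'a::euclidean_space set \<Rightarrow> real" where
  "intrinsic_volume j K = (THE v. \<exists>V. steiner_coeffs K V \<and> V j = v)"

lemma steiner_coeffs_unique:
  fixes K :: "'a::euclidean_space set"
  assumes V: "steiner_coeffs K V" and W: "steiner_coeffs K W" and j: "j \<le> DIM('a)"
  shows "V j = W j"
proof -
  let ?n = "DIM('a)"
  define c where "c i = unit_ball_vol (real i) * (V (?n - i) - W (?n - i))" for i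
  have zero: "(\<Sum>i\<le>?n. c i * t ^ i) = 0" if "t \<ge> 0" for t
  proof -
    have eq: "(\<Sum>j\<le>?n. unit_ball_vol (real (?n - j)) * V j * t ^ (?n - j)) =
          (\<Sum>j\<le>?n. unit_ball_vol (real (?n - j)) * W j * t ^ (?n - j))"
      using V W that unfolding steiner_coeffs_def by auto
    have "(\<Sum>i\<le>?n. c i * t ^ i) = (\<Sum>j\<le>?n. c (?n - j) * t ^ (?n - j))"
      by (rule sum.reindex_bij_witness[where i = "\<lambda>i. ?n - i" and j = "\<lambda>i. ?n - i"]) auto
    also have "\<dots> = (\<Sum>j\<le>?n. unit_ball_vol (real (?n - j)) * V j * t ^ (?n - j)
                         - unit_ball_vol (real (?n - j)) * W j * t ^ (?n - j))"
      by (rule sum.cong) (auto simp: c_def algebra_simps)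
    also have "\<dots> = 0"
      using eq by (simp add: sum_subtractf)
    finally show ?thesis .
  qed
  have "\<not> finite {t. (\<Sum>i\<le>?n. c i * t ^ i) = 0}"
  proof
    assume "finite {t. (\<Sum>i\<le>?n. c i * t ^ i) = 0}"
    then have "finite {0::real..}"
      by (rule finite_subset[rotated]) (use zero in auto)
    then show False
      using infinite_Ici by blast
  qed
  then have "\<forall>i\<le>?n. c i = 0"
    unfolding polyfun_finite_roots by blast
  then have "c (?n - j) = 0"
    by simp
  moreover have "unit_ball_vol (real (?n - j)) \<noteq> 0"
    using unit_ball_vol_pos[of "real (?n - j)"] by linarith
  ultimately show ?thesis
    using j by (simp add: c_def)
qed

lemma intrinsic_volume_eqI:
  fixes K :: "'a::euclidean_space set"
  assumes "steiner_coeffs K V" and "j \<le> DIM('a)"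
  shows "intrinsic_volume j K = V j"
  unfolding intrinsic_volume_def
proof (rule the_equality)
  show "\<exists>W. steiner_coeffs K W \<and> W j = V j"
    using assms(1) by (intro exI conjI) auto
  show "v = V j" if "\<exists>W. steiner_coeffs K W \<and> W j = v" for v
    using that steiner_coeffs_unique[OF assms(1) _ assms(2)] by metis
qed

definition lp_ball :: "real \<Rightarrow> (real ^ 'n) set" where
  "lp_ball p = {x. (\<Sum>i\<in>UNIV. \<bar>x $ i\<bar> powr p) \<le> 1}"

definition lp_weight :: "real \<Rightarrow> real \<Rightarrow> real \<Rightarrow> real" where
  "lp_weight p \<theta> x = exp (- (\<bar>x\<bar> powr p) - \<theta> * \<bar>x\<bar> powr (2 * p - 2))"

definition I_fun :: "real \<Rightarrow> real \<Rightarrow> real" where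
  "I_fun p \<theta> = (LBINT x. lp_weight p \<theta> x)"

text \<open>
  For \<open>p \<le> 2\<close> the library convention \<open>0 powr a = 0\<close> only affects the integrand at the null
  set \<open>{0}\<close>.
\<close>

definition J_fun :: "real \<Rightarrow> real \<Rightarrow> real" where
  "J_fun p \<theta> = (LBINT x. \<bar>x\<bar> powr (p - 2) * lp_weight p \<theta> x)"

definition K_fun :: "real \<Rightarrow> real \<Rightarrow> real" where
  "K_fun p \<theta> = (LBINT x. \<bar>x\<bar> powr (2 * p - 2) * lp_weight p \<theta> x)"

end

theory Submission
  imports Defs
begin

text \<open>
  Write \<open>f x = (\<Sum>i. \<bar>x $ i\<bar> powr p)\<close>, let \<open>G\<close> be the gradient of \<open>f / p\<close> and \<open>r x = f x powr (1 / p)\<close>.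
  For \<open>\<tau> \<ge> 0\<close> the map \<open>x \<mapsto> x + \<tau> G(x)\<close> is a bijection of space that acts on each coordinate
  separately, so its Jacobian is the product of the factors \<open>1 + \<tau> (p - 1) \<bar>x $ i\<bar> powr (p - 2)\<close> and
  only one-dimensional substitutions are needed. The point \<open>y = x + \<tau> G(x)\<close> lies on the outer
  normal at \<open>x\<close> to the dilate of the ball by the factor \<open>r x\<close>, hence \<open>y\<close> belongs to the dilate of
  the parallel body at distance \<open>t\<close> by the same factor if and only if \<open>\<tau> \<bar>G(x)\<bar> \<le> t r x\<close>.

  For fixed \<open>y\<close> the value \<open>s = f x\<close> decreases from \<open>f y\<close> to \<open>0\<close> as \<open>\<tau>\<close> grows. Substituting \<open>s\<close>
  by \<open>\<tau>\<close> and then \<open>y\<close> by \<open>x\<close> in the integral of \<open>exp (- s)\<close> over the pairs \<open>(y, s)\<close> such that \<open>y\<close>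
  lies between the dilates by \<open>s powr (1 / p)\<close> of the ball and of the parallel body gives an
  integral in \<open>x\<close> and \<open>\<tau>\<close> whose integrand is a polynomial in \<open>\<tau>\<close>, cut off at \<open>\<tau> = t r x / \<bar>G(x)\<bar>\<close>.
  Its \<open>\<tau>\<close>-integral is a polynomial in \<open>t\<close>, which is the Steiner polynomial. Each coefficient
  is an integral of \<open>exp (- f x)\<close> against a homogeneous function containing \<open>\<bar>G(x)\<bar>\<close> to the
  power \<open>- m\<close>; the Gamma integral for this power introduces \<open>\<theta>\<close>, after which the integrand is a
  product over the coordinates.
\<close>

section \<open>Coordinatewise flows\<close>

text \<open>The change of variables for absolutely integrable functions says, for each real
  \<open>b\<close>, that one integral exists and equals \<open>b\<close> exactly when the other
  does. For nonnegative integrands this becomes equality of the extended integrals: two extended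
  nonnegative numbers that equal the same finite values coincide, so infinite integrals are
  covered.\<close>

lemma nn_integral_subst_real:
  fixes f g g' :: "real \<Rightarrow> real"
  assumes S [measurable]: "S \<in> sets borel" and gS [measurable]: "g ` S \<in> sets borel"
    and f [measurable]: "f \<in> borel_measurable borel" and f0: "\<And>x. 0 \<le> f x"
    and m [measurable]: "(\<lambda>x. indicator S x * (\<bar>g' x\<bar> * f (g x))) \<in> borel_measurable borel"
    and der: "\<And>x. x \<in> S \<Longrightarrow> (g has_real_derivative g' x) (at x within S)"
    and inj: "inj_on g S"
  shows "(\<integral>\<^sup>+x. ennreal (indicator (g ` S) x * f x) \<partial>lborel)
       = (\<integral>\<^sup>+x. ennreal (indicator S x * (\<bar>g' x\<bar> * f (g x))) \<partial>lborel)" (is "?L = ?R")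
proof -
  have cv: "(\<lambda>x. \<bar>g' x\<bar> * f(g x)) absolutely_integrable_on S \<and>
           integral S (\<lambda>x. \<bar>g' x\<bar> * f (g x)) = b
     \<longleftrightarrow> f absolutely_integrable_on (g ` S) \<and> integral (g ` S) f = b" for b
    by (rule has_absolute_integral_change_of_variables_1') (use der inj S in auto)
  have eq: "(F absolutely_integrable_on A \<and> integral A F = b)
      \<longleftrightarrow> (\<integral>\<^sup>+x. ennreal (indicator A x * F x) \<partial>lborel) = ennreal b"
    if [measurable]: "A \<in> sets borel" "(\<lambda>x. indicator A x * F x) \<in> borel_measurable borel"
      and F0: "\<And>x. x \<in> A \<Longrightarrow> 0 \<le> F x" and b: "0 \<le> b" for F :: "real \<Rightarrow> real" and A b
  proof -
    have nn: "0 \<le> indicator A x * F x" for x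
      using F0 by (auto simp: indicator_def)
    have abs: "F absolutely_integrable_on A \<longleftrightarrow> integrable lborel (\<lambda>x. indicator A x * F x)"
      unfolding set_integrable_def by (simp add: integrable_completion)
    have val: "integral A F = integral\<^sup>L lborel (\<lambda>x. indicator A x * F x)"
      if "F absolutely_integrable_on A"
      using set_lebesgue_integral_eq_integral(2)[OF that]
      by (simp add: set_lebesgue_integral_def integral_completion)
    show ?thesis
    proof
      assume "F absolutely_integrable_on A \<and> integral A F = b"
      then show "(\<integral>\<^sup>+x. ennreal (indicator A x * F x) \<partial>lborel) = ennreal b"
        using nn_integral_eq_integral[of lborel "\<lambda>x. indicator A x * F x"] abs val nn by auto
    next
      assume *: "(\<integral>\<^sup>+x. ennreal (indicator A x * F x) \<partial>lborel) = ennreal b"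
      then have i: "integrable lborel (\<lambda>x. indicator A x * F x)"
        using nn by (intro integrableI_nn_integral_finite) auto
      then show "F absolutely_integrable_on A \<and> integral A F = b"
        using abs val nn_integral_eq_integral[OF i] nn * b by (auto simp: integral_nonneg_AE)
    qed
  qed
  have L: "f absolutely_integrable_on (g ` S) \<and> integral (g ` S) f = b \<longleftrightarrow> ?L = ennreal b"
    if "0 \<le> b" for b
    by (rule eq) (use that f0 in auto)
  have R: "(\<lambda>x. \<bar>g' x\<bar> * f(g x)) absolutely_integrable_on S \<and>
      integral S (\<lambda>x. \<bar>g' x\<bar> * f (g x)) = b \<longleftrightarrow> ?R = ennreal b" if "0 \<le> b" for b
    by (rule eq) (use that f0 in auto)
  have eqv: "?L = ennreal b \<longleftrightarrow> ?R = ennreal b" if "0 \<le> b" for b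
    using cv[of b] L[OF that] R[OF that] by simp
  show ?thesis
  proof (cases ?L rule: ennreal_cases)
    case (real r)
    then show ?thesis using eqv[of r] by simp
  next
    case top
    then show ?thesis using eqv by (cases ?R rule: ennreal_cases) auto
  qed
qed

section \<open>The one-dimensional flow and its Jacobian\<close>

definition flow :: "real \<Rightarrow> real \<Rightarrow> real \<Rightarrow> real" where
  "flow p \<tau> x = x + \<tau> * (sgn x * \<bar>x\<bar> powr (p - 1))"

definition flow_deriv :: "real \<Rightarrow> real \<Rightarrow> real \<Rightarrow> real" where
  "flow_deriv p \<tau> x = 1 + \<tau> * ((p - 1) * \<bar>x\<bar> powr (p - 2))"

lemma flow_minus: "flow p \<tau> (- x) = - flow p \<tau> x"
  by (simp add: flow_def sgn_minus)

lemma flow_0 [simp]: "flow p \<tau> 0 = 0"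
  by (simp add: flow_def)

lemma sgn_powr_strict_mono:
  fixes x y :: real
  assumes p: "1 < p" and xy: "x < y"
  shows "sgn x * \<bar>x\<bar> powr (p - 1) < sgn y * \<bar>y\<bar> powr (p - 1)"
proof -
  consider "0 \<le> x" | "x < 0" "0 \<le> y" | "y < 0" using xy by linarith
  then show ?thesis
  proof cases
    case 1
    then show ?thesis using xy p powr_less_mono2[of "p - 1" x y] by (auto simp: sgn_if)
  next
    case 2
    then have "sgn x * \<bar>x\<bar> powr (p - 1) < 0" "0 \<le> sgn y * \<bar>y\<bar> powr (p - 1)"
      by (auto simp: sgn_if)
    then show ?thesis by linarith
  next
    case 3
    then show ?thesis using xy p powr_less_mono2[of "p - 1" "- y" "- x"] by (auto simp: sgn_if)
  qed
qed

lemma flow_strict_mono: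
  assumes p: "1 < p" and t: "0 \<le> \<tau>"
  shows "strict_mono (flow p \<tau>)"
proof (rule strict_monoI)
  fix x y :: real assume xy: "x < y"
  have "\<tau> * (sgn x * \<bar>x\<bar> powr (p - 1)) \<le> \<tau> * (sgn y * \<bar>y\<bar> powr (p - 1))"
    using sgn_powr_strict_mono[OF p xy] t by (intro mult_left_mono) auto
  then show "flow p \<tau> x < flow p \<tau> y" using xy by (simp add: flow_def)
qed

lemma sgn_powr_continuous:
  assumes p: "1 < p"
  shows "continuous_on UNIV (\<lambda>x::real. sgn x * \<bar>x\<bar> powr (p - 1))"
proof -
  \<comment> \<open>The sign function jumps at the origin, so the odd power is split into positive
    and negative parts, whose bases are continuous and nonnegative.\<close>
  have e: "sgn x * \<bar>x\<bar> powr (p - 1) = (max x 0) powr (p - 1) - (max (- x) 0) powr (p - 1)" for x :: real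
    by (auto simp: sgn_if max_def)
  show ?thesis unfolding e
    by (intro continuous_on_diff continuous_on_powr' continuous_on_max continuous_on_const continuous_on_id continuous_on_minus)
       (use p in auto)
qed

lemma flow_continuous: "1 < p \<Longrightarrow> continuous_on UNIV (flow p \<tau>)"
  unfolding flow_def[abs_def]
  by (intro continuous_on_add continuous_on_id continuous_on_mult continuous_on_const sgn_powr_continuous)

lemma flow_expands:
  assumes "0 \<le> \<tau>"
  shows "0 \<le> x \<Longrightarrow> x \<le> flow p \<tau> x" "x \<le> 0 \<Longrightarrow> flow p \<tau> x \<le> x"
  using assms by (auto simp: flow_def sgn_if mult_le_0_iff)

lemma bij_flow:
  assumes p: "1 < p" and t: "0 \<le> \<tau>"
  shows "bij (flow p \<tau>)"
proof (rule bijI)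
  show "inj (flow p \<tau>)" using flow_strict_mono[OF assms] strict_mono_imp_inj_on by blast
  show "surj (flow p \<tau>)"
  proof (rule surjI[of _ "\<lambda>y. SOME x. flow p \<tau> x = y"])
    fix y :: real
    \<comment> \<open>The flow moves points away from the origin, so its values at
      \<open>- \<bar>y\<bar>\<close> and \<open>\<bar>y\<bar>\<close> enclose
      \<open>y\<close>.\<close>
    have "\<exists>x. - \<bar>y\<bar> \<le> x \<and> x \<le> \<bar>y\<bar> \<and> flow p \<tau> x = y"
    proof (rule IVT')
      show "flow p \<tau> (- \<bar>y\<bar>) \<le> y" using flow_expands(2)[OF t, of "- \<bar>y\<bar>" p] by linarith
      show "y \<le> flow p \<tau> \<bar>y\<bar>" using flow_expands(1)[OF t, of "\<bar>y\<bar>" p] by linarith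
      show "continuous_on {- \<bar>y\<bar>..\<bar>y\<bar>} (flow p \<tau>)"
        using flow_continuous[OF p] continuous_on_subset by blast
    qed simp
    then show "flow p \<tau> (SOME x. flow p \<tau> x = y) = y" by (metis (mono_tags, lifting) someI_ex)
  qed
qed

lemma has_derivative_sgn_powr:
  assumes "x \<noteq> (0::real)"
  shows "((\<lambda>x. sgn x * \<bar>x\<bar> powr a) has_real_derivative a * \<bar>x\<bar> powr (a - 1)) (at x within S)"
proof -
  have "((\<lambda>x. sgn x * \<bar>x\<bar> powr a) has_real_derivative a * \<bar>x\<bar> powr (a - 1)) (at x)"
  proof (cases "x > 0")
    case True
    have d: "((\<lambda>x. x powr a) has_real_derivative a * x powr (a - 1)) (at x)"
      using True by (auto intro!: derivative_eq_intros)
    show ?thesis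
      by (rule has_field_derivative_transform_within_open[where S = "{0<..}", OF _ open_greaterThan])
        (use True d in auto)
  next
    case False
    then have n: "x < 0" using assms by simp
    have d: "((\<lambda>x. - ((- x) powr a)) has_real_derivative a * (- x) powr (a - 1)) (at x)"
      using n by (auto intro!: derivative_eq_intros)
    show ?thesis
      by (rule has_field_derivative_transform_within_open[where S = "{..<0}", OF _ open_lessThan])
        (use n d in auto)
  qed
  then show ?thesis by (rule has_field_derivative_at_within)
qed

text \<open>The origin is excluded: for \<open>p < 2\<close> and \<open>\<tau> > 0\<close> the slope
  there is infinite, and for \<open>p = 2\<close> the convention \<open>0 powr 0 = 0\<close> spoils
  the value of \<open>flow_deriv\<close>.\<close>

lemma flow_has_derivative:
  assumes "x \<noteq> 0"
  shows "(flow p \<tau> has_real_derivative flow_deriv p \<tau> x) (at x within S)"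
  unfolding flow_def[abs_def] flow_deriv_def
  by (rule DERIV_cong[OF DERIV_add[OF DERIV_ident DERIV_cmult[OF has_derivative_sgn_powr[OF assms]]]]) (simp add: diff_diff_eq)

lemma flow_measurable [measurable]: "flow p \<tau> \<in> borel_measurable borel"
  unfolding flow_def[abs_def] by measurable

lemma flow_deriv_measurable [measurable (raw)]:
  assumes [measurable]: "f \<in> borel_measurable M" "g \<in> borel_measurable M"
  shows "(\<lambda>x. flow_deriv p (f x) (g x)) \<in> borel_measurable M"
  unfolding flow_deriv_def by measurable

lemma flow_deriv_pos: "1 < p \<Longrightarrow> 0 \<le> \<tau> \<Longrightarrow> 0 < flow_deriv p \<tau> x"
  by (simp add: flow_deriv_def add_pos_nonneg)

text \<open>The substitution is carried out off the origin, which is a null set and a fixed point of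
  the flow. Intervals suffice, since \<open>lborel_flow\<close> compares measures on boxes.\<close>

lemma nn_integral_flow_interval:
  assumes p: "1 < p" and t: "0 \<le> \<tau>" and le: "l \<le> u"
  shows "(\<integral>\<^sup>+x. ennreal (flow_deriv p \<tau> x * indicator {l<..<u} (flow p \<tau> x)) \<partial>lborel) = ennreal (u - l)"
proof -
  have inj: "inj (flow p \<tau>)" and sur: "surj (flow p \<tau>)"
    using bij_flow[OF p t] by (auto simp: bij_def)
  have im: "flow p \<tau> ` (- {0}) = - {0}"
    using sur inj by (metis flow_0 bij_image_Compl_eq bij_flow[OF p t] image_empty image_insert)
  have "(\<integral>\<^sup>+x. ennreal (indicator (flow p \<tau> ` (- {0})) x * indicator {l<..<u} x) \<partial>lborel)
      = (\<integral>\<^sup>+x. ennreal (indicator (- {0}) x * (\<bar>flow_deriv p \<tau> x\<bar> * indicator {l<..<u} (flow p \<tau> x))) \<partial>lborel)"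
    by (rule nn_integral_subst_real)
       (use flow_has_derivative inj in \<open>auto simp: im intro: inj_on_subset\<close>)
  also have "\<dots> = (\<integral>\<^sup>+x. ennreal (flow_deriv p \<tau> x * indicator {l<..<u} (flow p \<tau> x)) \<partial>lborel)"
    using AE_lborel_singleton[of "0::real"] flow_deriv_pos[OF p t]
    by (intro nn_integral_cong_AE) (auto elim!: eventually_mono simp: less_imp_le)
  also have "(\<integral>\<^sup>+x. ennreal (indicator (flow p \<tau> ` (- {0})) x * indicator {l<..<u} x) \<partial>lborel)
     = (\<integral>\<^sup>+x. indicator {l<..<u} x \<partial>lborel)"
    unfolding im using AE_lborel_singleton[of "0::real"]
    by (intro nn_integral_cong_AE) (auto elim!: eventually_mono simp: indicator_def)
  also have "\<dots> = ennreal (u - l)" using le by simp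
  finally show ?thesis by simp
qed

section \<open>Products over coordinates and the Jacobian of the flow in space\<close>

lemma prod_Basis_vec:
  fixes h :: "'n::finite \<Rightarrow> 'a::comm_monoid_mult"
  shows "(\<Prod>b\<in>(Basis :: (real^'n) set). h (THE i. b = axis i 1)) = (\<Prod>i\<in>UNIV. h i)"
proof -
  have B: "(Basis :: (real^'n) set) = range (\<lambda>i. axis i 1)"
    by (auto simp: Basis_vec_def)
  have inj: "inj (\<lambda>i::'n. axis i (1::real))"
    by (auto simp: inj_def axis_eq_axis)
  show ?thesis unfolding B by (subst prod.reindex[OF inj]) (simp add: axis_eq_axis)
qed

lemma nn_integral_lborel_vec_prod:
  fixes f :: "'n::finite \<Rightarrow> real \<Rightarrow> ennreal"
  assumes [measurable]: "\<And>i. f i \<in> borel_measurable borel"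
  shows "(\<integral>\<^sup>+x. (\<Prod>i\<in>UNIV. f i (x $ i)) \<partial>(lborel :: (real^'n) measure)) = (\<Prod>i\<in>UNIV. \<integral>\<^sup>+x. f i x \<partial>lborel)"
proof -
  define F where "F b = f (THE i. b = axis i 1)" for b :: "real^'n"
  have "(\<Prod>i\<in>UNIV. f i (x $ i)) = (\<Prod>b\<in>Basis. F b (x \<bullet> b))" for x :: "real^'n"
  proof -
    have "(\<Prod>b\<in>Basis. F b (x \<bullet> b)) = (\<Prod>b\<in>(Basis :: (real^'n) set). (\<lambda>i. f i (x $ i)) (THE i. b = axis i 1))"
      by (rule prod.cong) (auto simp: F_def Basis_vec_def axis_eq_axis cart_eq_inner_axis)
    then show ?thesis using prod_Basis_vec[of "\<lambda>i. f i (x $ i)"] by simp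
  qed
  moreover have "(\<integral>\<^sup>+x. (\<Prod>b\<in>Basis. F b (x \<bullet> b)) \<partial>(lborel :: (real^'n) measure)) = (\<Prod>b\<in>Basis. (\<integral>\<^sup>+x. F b x \<partial>lborel))"
    by (rule nn_integral_lborel_prod) (auto simp: F_def)
  moreover have "\<dots> = (\<Prod>i\<in>UNIV. \<integral>\<^sup>+x. f i x \<partial>lborel)"
    unfolding F_def using prod_Basis_vec[of "\<lambda>i. \<integral>\<^sup>+x. f i x \<partial>lborel"] by simp
  ultimately show ?thesis by simp
qed

lemma borel_measurable_vec_lambda [measurable]:
  fixes f :: "'n::finite \<Rightarrow> 'a \<Rightarrow> real"
  assumes [measurable]: "\<And>i. f i \<in> borel_measurable M"
  shows "(\<lambda>x. \<chi> i. f i x) \<in> borel_measurable M"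
  by (rule borel_measurable_euclidean_space[THEN iffD2]) (auto simp: Basis_vec_def inner_axis)

lemma AE_lborel_vec_neq: "AE x in (lborel :: (real^'n::finite) measure). \<forall>i. x $ i \<noteq> c"
proof -
  have "AE x in (lborel :: (real^'n) measure). x $ i \<noteq> c" for i
    using AE_lborel_inner_neq[of "axis i (1::real) :: real^'n" c]
    by (simp add: axis_in_Basis_iff cart_eq_inner_axis)
  then show ?thesis by (simp add: AE_all_countable)
qed

text \<open>Lebesgue measure is determined by its values on open boxes. Both the preimage of a box
  under a coordinatewise map and the density factor over the coordinates, so each box reduces to the
  intervals of \<open>nn_integral_flow_interval\<close>.\<close>

lemma lborel_flow:
  fixes \<tau> :: real
  assumes p: "1 < p" and t: "0 \<le> \<tau>"
  shows "(lborel :: (real^'n::finite) measure) = distr (density lborel (\<lambda>x. ennreal (\<Prod>i\<in>UNIV. flow_deriv p \<tau> (x $ i))))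
     borel (\<lambda>x. \<chi> i. flow p \<tau> (x $ i))"
proof (rule lborel_eqI)
  fix l u :: "real^'n"
  assume le: "\<And>b. b \<in> Basis \<Longrightarrow> l \<bullet> b \<le> u \<bullet> b"
  have le': "l $ i \<le> u $ i" for i
    using le[of "axis i 1"] by (simp add: cart_eq_inner_axis axis_in_Basis_iff)
  have "emeasure (distr (density lborel (\<lambda>x. ennreal (\<Prod>i\<in>UNIV. flow_deriv p \<tau> (x $ i))))
     borel (\<lambda>x. \<chi> i. flow p \<tau> (x $ i))) (box l u)
     = (\<integral>\<^sup>+x. ennreal (\<Prod>i\<in>UNIV. flow_deriv p \<tau> (x $ i)) * indicator (box l u) (\<chi> i. flow p \<tau> (x $ i)) \<partial>lborel)"
    by (subst nn_integral_indicator[symmetric], simp, subst nn_integral_distr, simp, simp, subst nn_integral_density)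
       auto
  also have "\<dots> = (\<integral>\<^sup>+x. (\<Prod>i\<in>UNIV. ennreal (flow_deriv p \<tau> (x $ i) * indicator {l $ i<..<u $ i} (flow p \<tau> (x $ i)))) \<partial>lborel)"
  proof (rule nn_integral_cong)
    fix x :: "real^'n"
    have "(indicator (box l u) (\<chi> i. flow p \<tau> (x $ i)) :: real) = (\<Prod>i\<in>UNIV. indicator {l $ i<..<u $ i} (flow p \<tau> (x $ i)))"
      by (auto simp: indicator_def mem_box_cart prod.neutral)
    then show "ennreal (\<Prod>i\<in>UNIV. flow_deriv p \<tau> (x $ i)) * indicator (box l u) (\<chi> i. flow p \<tau> (x $ i))
       = (\<Prod>i\<in>UNIV. ennreal (flow_deriv p \<tau> (x $ i) * indicator {l $ i<..<u $ i} (flow p \<tau> (x $ i))))"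
      using flow_deriv_pos[OF p t]
      by (subst prod_ennreal)
         (simp_all add: prod.distrib ennreal_mult prod_nonneg less_imp_le ennreal_indicator[symmetric])
  qed
  also have "\<dots> = (\<Prod>i\<in>UNIV. \<integral>\<^sup>+x. ennreal (flow_deriv p \<tau> x * indicator {l $ i<..<u $ i} (flow p \<tau> x)) \<partial>lborel)"
    by (rule nn_integral_lborel_vec_prod) simp
  also have "\<dots> = (\<Prod>i\<in>UNIV. ennreal (u $ i - l $ i))"
    using nn_integral_flow_interval[OF p t] le' by simp
  also have "\<dots> = ennreal (\<Prod>b\<in>Basis. (u - l) \<bullet> b)"
  proof -
    have "(\<Prod>b\<in>Basis. (u - l) \<bullet> b) = (\<Prod>b\<in>(Basis :: (real^'n) set). (\<lambda>i. u $ i - l $ i) (THE i. b = axis i 1))"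
      by (rule prod.cong) (auto simp: Basis_vec_def axis_eq_axis cart_eq_inner_axis inner_diff_left)
    then show ?thesis using prod_Basis_vec[of "\<lambda>i. u $ i - l $ i"] le' by (simp add: prod_ennreal)
  qed
  finally show "emeasure (distr (density lborel (\<lambda>x. ennreal (\<Prod>i\<in>UNIV. flow_deriv p \<tau> (x $ i))))
     borel (\<lambda>x. \<chi> i. flow p \<tau> (x $ i))) (box l u) = ennreal (\<Prod>b\<in>Basis. (u - l) \<bullet> b)" .
qed simp

section \<open>Parallel bodies and the normal flow\<close>

definition lp_sum :: "real \<Rightarrow> real ^ 'n::finite \<Rightarrow> real" where
  "lp_sum p x = (\<Sum>i\<in>UNIV. \<bar>x $ i\<bar> powr p)"

definition lp_grad :: "real \<Rightarrow> real ^ 'n::finite \<Rightarrow> real ^ 'n" where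
  "lp_grad p x = (\<chi> i. sgn (x $ i) * \<bar>x $ i\<bar> powr (p - 1))"

text \<open>Written exactly as the set in \<open>steiner_coeffs\<close>, so that
  \<open>steiner_coeffs_lp_ball\<close> can fold it.\<close>

definition lp_parallel :: "real \<Rightarrow> real \<Rightarrow> (real ^ 'n::finite) set" where
  "lp_parallel p t = {x + t *\<^sub>R u | x u. x \<in> lp_ball p \<and> u \<in> cball 0 1}"

lemma lp_ball_eq: "lp_ball p = {x. lp_sum p x \<le> 1}"
  by (simp add: lp_ball_def lp_sum_def)

lemma lp_sum_nonneg: "0 \<le> lp_sum p x"
  by (simp add: lp_sum_def sum_nonneg)

lemma lp_sum_pos: "x \<noteq> 0 \<Longrightarrow> 0 < lp_sum p x"
  unfolding lp_sum_def by (auto simp: vec_eq_iff intro!: sum_pos2)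

lemma lp_sum_scaleR: "lp_sum p (c *\<^sub>R x) = \<bar>c\<bar> powr p * lp_sum p x"
  by (simp add: lp_sum_def abs_mult powr_mult sum_distrib_left)

lemma lp_grad_scaleR: "0 < c \<Longrightarrow> lp_grad p (c *\<^sub>R x) = c powr (p - 1) *\<^sub>R lp_grad p x"
proof -
  assume c: "0 < c"
  have "sgn (c * a) * \<bar>c * a\<bar> powr (p - 1) = c powr (p - 1) * (sgn a * \<bar>a\<bar> powr (p - 1))" for a :: real
    using c by (simp add: sgn_mult abs_mult powr_mult)
  then show ?thesis by (simp add: lp_grad_def vec_eq_iff)
qed

text \<open>Euler's identity for a function homogeneous of degree \<open>p\<close>, whose gradient
  here carries the factor \<open>1 / p\<close>.\<close>

lemma lp_grad_inner_self: "lp_grad p x \<bullet> x = lp_sum p x"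
proof -
  have "sgn a * \<bar>a\<bar> powr (p - 1) * a = \<bar>a\<bar> powr p" for a :: real
  proof (cases "a = 0")
    case False
    then have "sgn a * \<bar>a\<bar> powr (p - 1) * a = \<bar>a\<bar> powr (p - 1) * \<bar>a\<bar> powr 1"
      by (auto simp: sgn_if)
    then show ?thesis using False by (simp only: powr_add[symmetric]) simp
  qed simp
  then show ?thesis by (simp add: inner_vec_def lp_grad_def lp_sum_def)
qed

text \<open>The source of the exponent \<open>2 * p - 2\<close> in \<open>lp_weight\<close>: there
  \<open>\<theta>\<close> multiplies the squared length of the gradient.\<close>

lemma norm_lp_grad_sq: "norm (lp_grad p x) ^ 2 = (\<Sum>i\<in>UNIV. \<bar>x $ i\<bar> powr (2 * p - 2))"
proof -
  have "sgn a * \<bar>a\<bar> powr (p - 1) * (sgn a * \<bar>a\<bar> powr (p - 1)) = \<bar>a\<bar> powr (2 * p - 2)" for a :: real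
  proof -
    have "sgn a * \<bar>a\<bar> powr (p - 1) * (sgn a * \<bar>a\<bar> powr (p - 1)) = \<bar>a\<bar> powr (p - 1) * \<bar>a\<bar> powr (p - 1)"
      by (auto simp: sgn_if)
    also have "\<dots> = \<bar>a\<bar> powr (2 * p - 2)"
      by (simp only: powr_add[symmetric]) simp
    finally show ?thesis .
  qed
  then show ?thesis by (simp add: power2_norm_eq_inner inner_vec_def lp_grad_def)
qed

lemma lp_grad_eq_0_iff: "lp_grad p x = 0 \<longleftrightarrow> x = 0"
  by (auto simp: vec_eq_iff lp_grad_def sgn_eq_0_iff)

text \<open>Young's inequality in each coordinate, with conjugate exponents
  \<open>p / (p - 1)\<close> and \<open>p\<close>. Together with \<open>lp_grad_inner_self\<close>
  it shows that the hyperplane through \<open>x\<close> with normal \<open>lp_grad p x\<close>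
  supports the ball.\<close>

lemma lp_grad_inner_le:
  assumes p: "1 < p" and x: "lp_sum p x = 1" and z: "lp_sum p z \<le> 1"
  shows "lp_grad p x \<bullet> z \<le> 1"
proof -
  let ?q = "p / (p - 1)"
  have q: "1 < ?q" "1 / ?q + 1 / p = 1"
    using p by (auto simp: field_simps)
  have "lp_grad p x \<bullet> z \<le> (\<Sum>i\<in>UNIV. \<bar>x $ i\<bar> powr p / ?q + \<bar>z $ i\<bar> powr p / p)"
    unfolding inner_vec_def
  proof (rule sum_mono)
    fix i
    have "lp_grad p x $ i \<bullet> z $ i \<le> \<bar>x $ i\<bar> powr (p - 1) * \<bar>z $ i\<bar>"
      by (auto simp: lp_grad_def sgn_if abs_if intro: mult_nonneg_nonneg mult_nonneg_nonpos)
    also have "\<dots> \<le> (\<bar>x $ i\<bar> powr (p - 1)) powr ?q / ?q + \<bar>z $ i\<bar> powr p / p"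
      by (rule Youngs_inequality) (use p q in auto)
    also have "(\<bar>x $ i\<bar> powr (p - 1)) powr ?q = \<bar>x $ i\<bar> powr p"
      using p by (simp add: powr_powr)
    finally show "lp_grad p x $ i \<bullet> z $ i \<le> \<bar>x $ i\<bar> powr p / ?q + \<bar>z $ i\<bar> powr p / p" .
  qed
  also have "\<dots> = lp_sum p x / ?q + lp_sum p z / p"
    unfolding lp_sum_def sum_divide_distrib by (rule sum.distrib)
  also have "\<dots> \<le> 1 / ?q + 1 / p"
    using x z p by (intro add_mono divide_right_mono) auto
  finally show ?thesis using q by simp
qed

text \<open>Pairing with the normal \<open>G = lp_grad p x\<close> decides membership: the given
  point has inner product \<open>1 + s |G|^2\<close> with \<open>G\<close>, while by
  \<open>lp_grad_inner_le\<close> points of the parallel body reach at most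
  \<open>1 + t |G|\<close>. Conversely, \<open>x\<close> itself is a base point in the ball at
  distance \<open>s |G|\<close>.\<close>

lemma normal_point_in_parallel_iff:
  assumes p: "1 < p" and x: "lp_sum p x = 1" and s: "0 \<le> s" and t: "0 \<le> t"
  shows "x + s *\<^sub>R lp_grad p x \<in> lp_parallel p t \<longleftrightarrow> s * norm (lp_grad p x) \<le> t"
proof
  have x0: "x \<noteq> 0" using x by (auto simp: lp_sum_def)
  then have g: "0 < norm (lp_grad p x)" by (simp add: lp_grad_eq_0_iff)
  {
    assume "x + s *\<^sub>R lp_grad p x \<in> lp_parallel p t"
    then obtain z u where z: "lp_sum p z \<le> 1" and u: "norm u \<le> 1"
      and eq: "x + s *\<^sub>R lp_grad p x = z + t *\<^sub>R u"
      by (auto simp: lp_parallel_def lp_ball_eq)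
    have "1 + s * norm (lp_grad p x) ^ 2 = lp_grad p x \<bullet> (x + s *\<^sub>R lp_grad p x)"
      by (simp add: inner_add_right lp_grad_inner_self x power2_norm_eq_inner)
    also have "\<dots> = lp_grad p x \<bullet> z + t * (lp_grad p x \<bullet> u)"
      by (simp add: eq inner_add_right)
    also have "\<dots> \<le> 1 + t * (norm (lp_grad p x) * 1)"
      using lp_grad_inner_le[OF p x z] norm_cauchy_schwarz[of "lp_grad p x" u] u t
        mult_left_mono[OF u, of "norm (lp_grad p x)"]
      by (intro add_mono mult_left_mono) auto
    finally have "(s * norm (lp_grad p x)) * norm (lp_grad p x) \<le> t * norm (lp_grad p x)"
      by (simp add: power2_eq_square algebra_simps)
    then show "s * norm (lp_grad p x) \<le> t" using g by simp
  }
  {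
    assume le: "s * norm (lp_grad p x) \<le> t"
    show "x + s *\<^sub>R lp_grad p x \<in> lp_parallel p t"
    \<comment> \<open>The displacement witness \<open>(s / t) *\<^sub>R lp_grad p x\<close> divides
      by \<open>t\<close>; when \<open>t = 0\<close>, the inequality forces
      \<open>s = 0\<close>.\<close>
    proof (cases "t = 0")
      case True
      then have "s = 0" using le g s by (simp add: mult_le_0_iff)
      then show ?thesis using True x by (auto simp: lp_parallel_def lp_ball_eq intro!: exI[of _ x] exI[of _ 0])
    next
      case False
      then show ?thesis unfolding lp_parallel_def
        by (intro CollectI exI[of _ x] exI[of _ "(s / t) *\<^sub>R lp_grad p x"])
           (use t s le x in \<open>auto simp: lp_ball_eq field_simps\<close>)
    qed
  }
qed

text \<open>Division by \<open>r\<close> moves \<open>x\<close> to the boundary of the ball. The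
  gradient \<open>G\<close> has degree \<open>p - 1\<close>, so
  \<open>(s / r) G(x) = s r^(p-2) G(x / r)\<close>, and the boundary criterion applies with the
  parameter \<open>s r^(p-2)\<close>.\<close>

lemma scaled_normal_point_in_parallel_iff:
  assumes p: "1 < p" and x: "x \<noteq> 0" and s: "0 \<le> s" and t: "0 \<le> t"
  defines "r \<equiv> lp_sum p x powr (1 / p)"
  shows "(1 / r) *\<^sub>R (x + s *\<^sub>R lp_grad p x) \<in> lp_parallel p t \<longleftrightarrow> s * norm (lp_grad p x) \<le> t * r"
proof -
  have f: "0 < lp_sum p x" using lp_sum_pos[OF x] .
  then have r: "0 < r" by (simp add: r_def)
  have rp: "r powr p = lp_sum p x" using p f by (simp add: r_def powr_powr)
  let ?x = "(1 / r) *\<^sub>R x"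
  have sc: "lp_grad p ?x = (1 / r) powr (p - 1) *\<^sub>R lp_grad p x"
    using r by (intro lp_grad_scaleR) simp
  have one: "lp_sum p ?x = 1"
    using r f by (simp add: lp_sum_scaleR powr_divide rp)
  have pw: "r powr (p - 2) * (1 / r) powr (p - 1) = 1 / r"
    using r by (simp add: powr_divide powr_diff power2_eq_square field_simps)
  have eq: "(1 / r) *\<^sub>R (x + s *\<^sub>R lp_grad p x) = ?x + (s * r powr (p - 2)) *\<^sub>R lp_grad p ?x"
    using pw by (simp add: sc scaleR_add_right mult.assoc)
  have "(1 / r) *\<^sub>R (x + s *\<^sub>R lp_grad p x) \<in> lp_parallel p t \<longleftrightarrow> (s * r powr (p - 2)) * norm (lp_grad p ?x) \<le> t"
    unfolding eq by (rule normal_point_in_parallel_iff) (use p s t one in auto)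
  also have "(s * r powr (p - 2)) * norm (lp_grad p ?x) = s * (r powr (p - 2) * (1 / r) powr (p - 1)) * norm (lp_grad p x)"
    by (simp add: sc)
  also have "\<dots> = s * norm (lp_grad p x) / r" unfolding pw by simp
  also have "s * norm (lp_grad p x) / r \<le> t \<longleftrightarrow> s * norm (lp_grad p x) \<le> t * r"
    using r by (simp add: field_simps)
  finally show ?thesis .
qed

section \<open>Compactness of the ball and its parallel bodies\<close>

lemma continuous_on_lp_sum: "0 < p \<Longrightarrow> continuous_on UNIV (lp_sum p :: real^'n::finite \<Rightarrow> real)"
  unfolding lp_sum_def[abs_def]
  by (intro continuous_on_sum continuous_on_powr' continuous_intros) auto

lemma compact_lp_ball: "0 < p \<Longrightarrow> compact (lp_ball p :: (real^'n::finite) set)"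
proof (rule compact_eq_bounded_closed[THEN iffD2], rule conjI)
  assume p: "0 < p"
  show "closed (lp_ball p :: (real^'n) set)"
    unfolding lp_ball_eq using continuous_on_lp_sum[OF p]
    by (intro closed_Collect_le continuous_on_const)
  have "\<bar>x $ i\<bar> \<le> 1" if "x \<in> lp_ball p" for x :: "real^'n" and i
  proof (rule ccontr)
    assume "\<not> \<bar>x $ i\<bar> \<le> 1"
    then have "1 < \<bar>x $ i\<bar> powr p" using p by (simp add: gr_one_powr)
    also have "\<dots> \<le> lp_sum p x" unfolding lp_sum_def by (rule member_le_sum) auto
    finally show False using that by (simp add: lp_ball_eq)
  qed
  then have "norm x \<le> (\<Sum>i\<in>(UNIV::'n set). 1)" if "x \<in> lp_ball p" for x :: "real^'n"
    using that norm_le_l1_cart[of x] by (meson order_trans sum_mono)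
  then show "bounded (lp_ball p :: (real^'n) set)" by (auto simp: bounded_iff)
qed

lemma compact_lp_parallel:
  assumes "0 < p"
  shows "compact (lp_parallel p t :: (real^'n::finite) set)"
proof -
  have "(lp_parallel p t :: (real^'n) set) = (\<lambda>(x, u). x + t *\<^sub>R u) ` (lp_ball p \<times> cball 0 1)"
    by (fastforce simp: lp_parallel_def)
  also have "compact \<dots>"
    by (intro compact_continuous_image compact_Times compact_lp_ball compact_cball assms)
       (auto intro!: continuous_intros simp: case_prod_beta)
  finally show ?thesis .
qed

lemma lp_ball_subset_parallel: "lp_ball p \<subseteq> lp_parallel p t"
  by (force simp: lp_parallel_def)

text \<open>\<open>flow p \<tau>\<close> is the identity plus \<open>\<tau>\<close> times the
  derivative of \<open>\<bar>x\<bar> powr p / p\<close>, so its inverse is the proximal map of that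
  convex function. By \<open>bij_flow\<close> it is a true inverse for \<open>p > 1\<close> and
  \<open>\<tau> \<ge> 0\<close>.\<close>

definition prox :: "real \<Rightarrow> real \<Rightarrow> real \<Rightarrow> real" where
  "prox p \<tau> = inv (flow p \<tau>)"

section \<open>Monotonicity, bounds and derivative of the inverse flow on the line\<close>

context
  fixes p :: real
  assumes p: "1 < p"
begin

lemma flow_prox: "0 \<le> \<tau> \<Longrightarrow> flow p \<tau> (prox p \<tau> y) = y"
  unfolding prox_def using bij_flow[OF p] by (simp add: bij_is_surj surj_f_inv_f)

lemma prox_flow: "0 \<le> \<tau> \<Longrightarrow> prox p \<tau> (flow p \<tau> x) = x"
  unfolding prox_def using bij_flow[OF p] by (simp add: bij_is_inj)

text \<open>Comparisons with the inverse, which has no closed form, become comparisons with the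
  explicit \<open>flow\<close>; the measurability of \<open>prox\<close> rests on this.\<close>

lemma prox_le_iff: "0 \<le> \<tau> \<Longrightarrow> prox p \<tau> y \<le> c \<longleftrightarrow> y \<le> flow p \<tau> c"
  using strict_mono_less_eq[OF flow_strict_mono[OF p], of \<tau> "prox p \<tau> y" c] flow_prox by simp

lemma less_prox_iff: "0 \<le> \<tau> \<Longrightarrow> c < prox p \<tau> y \<longleftrightarrow> flow p \<tau> c < y"
  using strict_mono_less[OF flow_strict_mono[OF p], of \<tau> c "prox p \<tau> y"] flow_prox by simp

lemma prox_minus: "0 \<le> \<tau> \<Longrightarrow> prox p \<tau> (- y) = - prox p \<tau> y"
  using prox_flow[of \<tau> "- prox p \<tau> y"] by (simp add: flow_minus flow_prox)

lemma prox_0: "0 \<le> \<tau> \<Longrightarrow> prox p \<tau> 0 = 0"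
  using prox_flow[of \<tau> 0] by simp

lemma prox_pos_iff: "0 \<le> \<tau> \<Longrightarrow> 0 < prox p \<tau> y \<longleftrightarrow> 0 < y"
  by (simp add: less_prox_iff)

lemma prox_eq_0_iff: "0 \<le> \<tau> \<Longrightarrow> prox p \<tau> y = 0 \<longleftrightarrow> y = 0"
  by (metis flow_0 flow_prox prox_0)

lemma abs_prox: "0 \<le> \<tau> \<Longrightarrow> \<bar>prox p \<tau> y\<bar> = prox p \<tau> \<bar>y\<bar>"
  using prox_pos_iff[of \<tau> y] prox_pos_iff[of \<tau> "- y"] prox_minus[of \<tau> y] prox_0[of \<tau>]
  by (cases "0 < y"; cases "y = 0") (auto simp: abs_if)

lemma prox_le: "0 \<le> \<tau> \<Longrightarrow> 0 \<le> y \<Longrightarrow> prox p \<tau> y \<le> y"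
  by (simp add: prox_le_iff flow_expands)

lemma prox_tau_0: "prox p 0 y = y"
  using prox_flow[of 0 y] by (simp add: flow_def)

text \<open>A larger \<open>\<tau>\<close> pushes positive points further out, so the preimage of a
  fixed \<open>y > 0\<close> moves inwards.\<close>

lemma prox_antimono:
  assumes "0 \<le> \<tau>" "\<tau> < \<tau>'" "0 < y"
  shows "prox p \<tau>' y < prox p \<tau> y"
proof -
  have x: "0 < prox p \<tau> y" using assms by (simp add: prox_pos_iff)
  have "y = flow p \<tau> (prox p \<tau> y)" using assms by (simp add: flow_prox)
  also have "\<dots> < flow p \<tau>' (prox p \<tau> y)" using x assms by (simp add: flow_def)
  finally have "\<not> prox p \<tau> y \<le> prox p \<tau>' y"
    using assms less_prox_iff[of \<tau>' "prox p \<tau> y" y] prox_le_iff[of \<tau>' y "prox p \<tau> y"]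
      flow_prox[of \<tau>' y] by auto
  then show ?thesis by simp
qed

text \<open>The preimage \<open>x\<close> satisfies \<open>x = y - \<tau> x^(p-1)\<close> and
  \<open>x \<le> y\<close>. This bound drives \<open>prox\<close> to \<open>y\<close> as
  \<open>\<tau>\<close> tends to \<open>0\<close>; \<open>prox_le_powr\<close>, which drops the
  summand \<open>x\<close> from \<open>x + \<tau> x^(p-1) = y\<close>, drives it to \<open>0\<close>
  as \<open>\<tau>\<close> tends to infinity.\<close>

lemma prox_ge: 
  assumes "0 \<le> \<tau>" "0 < y"
  shows "y - \<tau> * y powr (p - 1) \<le> prox p \<tau> y"
proof -
  have x: "0 < prox p \<tau> y" using assms by (simp add: prox_pos_iff)
  have "prox p \<tau> y = y - \<tau> * prox p \<tau> y powr (p - 1)"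
    using flow_prox[of \<tau> y] x assms by (simp add: flow_def)
  moreover have "\<tau> * prox p \<tau> y powr (p - 1) \<le> \<tau> * y powr (p - 1)"
    using assms x p prox_le[of \<tau> y] by (intro mult_left_mono powr_mono2) auto
  ultimately show ?thesis by linarith
qed

lemma prox_le_powr:
  assumes "0 < \<tau>" "0 < y"
  shows "prox p \<tau> y \<le> (y / \<tau>) powr (1 / (p - 1))"
proof -
  have x: "0 < prox p \<tau> y" using assms by (simp add: prox_pos_iff)
  have "\<tau> * prox p \<tau> y powr (p - 1) \<le> y"
    using flow_prox[of \<tau> y] x assms by (simp add: flow_def)
  then have "prox p \<tau> y powr (p - 1) \<le> y / \<tau>" using assms by (simp add: field_simps)
  then have "(prox p \<tau> y powr (p - 1)) powr (1 / (p - 1)) \<le> (y / \<tau>) powr (1 / (p - 1))"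
    using p by (intro powr_mono2) auto
  then show ?thesis using x p by (simp add: powr_powr)
qed

text \<open>The absolute value makes the parameter nonnegative on the whole product space. There
  \<open>prox_le_iff\<close> describes every sublevel set by an explicit inequality that is
  measurable in both variables.\<close>

lemma prox_measurable [measurable]:
  "(\<lambda>z. prox p \<bar>fst z\<bar> (snd z)) \<in> borel_measurable (borel \<Otimes>\<^sub>M borel)"
proof (rule borel_measurableI_le)
  fix c
  have "{z \<in> space (borel \<Otimes>\<^sub>M borel). prox p \<bar>fst z\<bar> (snd z) \<le> c}
      = {z \<in> space (borel \<Otimes>\<^sub>M borel). snd z \<le> c + \<bar>fst z\<bar> * (sgn c * \<bar>c\<bar> powr (p - 1))}"
    by (simp add: prox_le_iff flow_def)
  also have "\<dots> \<in> sets (borel \<Otimes>\<^sub>M borel)"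
    by (intro borel_measurable_le borel_measurable_add borel_measurable_times borel_measurable_abs
        borel_measurable_const measurable_fst measurable_snd)
  finally show "{z \<in> space (borel \<Otimes>\<^sub>M borel). prox p \<bar>fst z\<bar> (snd z) \<le> c} \<in> sets (borel \<Otimes>\<^sub>M borel)" .
qed

text \<open>For fixed \<open>y\<close> the relation \<open>flow p \<tau> x = y\<close> is solved for \<open>\<tau>\<close>
  instead of \<open>x\<close>, which makes \<open>prox\<close> the inverse of an explicit function.\<close>
lemma prox_has_derivative:
  assumes t: "0 < \<tau>" and y: "0 < y"
  shows "((\<lambda>\<tau>. prox p \<tau> y) has_real_derivative
     - (prox p \<tau> y powr (p - 1) / flow_deriv p \<tau> (prox p \<tau> y))) (at \<tau>)"
proof -
  define F where "F x = (y - x) * x powr (1 - p)" for x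
  define x where "x = prox p \<tau> y"
  have x: "0 < x" "x < y"
    using t y prox_pos_iff[of \<tau> y] prox_antimono[of 0 \<tau> y] by (auto simp: x_def prox_tau_0)
  have inv: "prox p (F z) y = z" if "z \<in> {0<..<y}" for z
  proof -
    have "flow p (F z) z = y"
      using that by (simp add: flow_def F_def mult.assoc powr_add[symmetric])
    moreover have "0 \<le> F z" using that by (simp add: F_def)
    ultimately show ?thesis using prox_flow[of "F z" z] by simp
  qed
  have eq: "x + \<tau> * x powr (p - 1) = y"
    using flow_prox[of \<tau> y] t x by (simp add: flow_def x_def)
  then have yx: "y - x = \<tau> * x powr (p - 1)" by simp
  have Fx: "F x = \<tau>" using x by (simp add: F_def yx powr_add[symmetric])
  have d: "0 < flow_deriv p \<tau> x" using flow_deriv_pos[OF p] t by simp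
  have "(F has_real_derivative (- 1 * x powr (1 - p) + (y - x) * ((1 - p) * x powr (1 - p - 1)))) (at x)"
    unfolding F_def[abs_def] using x by (auto intro!: derivative_eq_intros)
  moreover have "- 1 * x powr (1 - p) + (y - x) * ((1 - p) * x powr (1 - p - 1)) = - (flow_deriv p \<tau> x / x powr (p - 1))"
  proof -
    define a where "a = x powr (p - 1)"
    have a: "a > 0" "x powr (1 - p) = 1 / a" "x powr (1 - p - 1) = 1 / (a * x)" "x powr (p - 2) = a / x"
      using x powr_minus_divide[of x "p - 1"] powr_minus_divide[of x p] powr_diff[of x "p - 1" 1] powr_diff[of x p 1]
      by (simp_all add: a_def)
    show ?thesis unfolding yx flow_deriv_def a_def[symmetric] abs_of_pos[OF x(1)] a(2-4) using x(1) a(1)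
      by (simp add: field_simps)
  qed
  ultimately have dF: "(F has_real_derivative - (flow_deriv p \<tau> x / x powr (p - 1))) (at x)"
    by simp
  have "((\<lambda>\<tau>. prox p \<tau> y) has_derivative (*) (- (x powr (p - 1) / flow_deriv p \<tau> x))) (at (F x))"
  proof (rule has_derivative_inverse_strong[where S = "{0<..<y}" and f = F and x = x
        and f' = "(*) (- (flow_deriv p \<tau> x / x powr (p - 1)))"])
    show "continuous_on {0<..<y} F"
      unfolding F_def[abs_def] by (intro continuous_intros) auto
    show "(F has_derivative (*) (- (flow_deriv p \<tau> x / x powr (p - 1)))) (at x)"
      using dF by (simp add: has_field_derivative_def)
    show "(*) (- (flow_deriv p \<tau> x / x powr (p - 1))) \<circ> (*) (- (x powr (p - 1) / flow_deriv p \<tau> x)) = id"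
      using x d by (auto simp: fun_eq_iff)
  qed (use x inv in auto)
  then show ?thesis
    unfolding Fx has_field_derivative_def unfolding x_def .
qed

end

text \<open>The rate at which \<open>lp_sum p x\<close> decreases in \<open>\<tau>\<close> while
  \<open>y = flow_vec p \<tau> x\<close> stays fixed: the derivative of each summand times the
  velocity from \<open>prox_has_derivative\<close>, with the sign reversed.\<close>

definition speed :: "real \<Rightarrow> real \<Rightarrow> real ^ 'n::finite \<Rightarrow> real" where
  "speed p \<tau> x = (\<Sum>i\<in>UNIV. p * \<bar>x $ i\<bar> powr (2 * p - 2) / flow_deriv p \<tau> (x $ i))"

definition flow_vec :: "real \<Rightarrow> real \<Rightarrow> real ^ 'n::finite \<Rightarrow> real ^ 'n" where
  "flow_vec p \<tau> x = (\<chi> i. flow p \<tau> (x $ i))"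

definition prox_vec :: "real \<Rightarrow> real \<Rightarrow> real ^ 'n::finite \<Rightarrow> real ^ 'n" where
  "prox_vec p \<tau> y = (\<chi> i. prox p \<tau> (y $ i))"

lemma flow_vec_eq: "flow_vec p \<tau> x = x + \<tau> *\<^sub>R lp_grad p x"
  by (simp add: flow_vec_def lp_grad_def flow_def vec_eq_iff)

lemma borel_measurable_vec_nth' [measurable (raw)]:
  "f \<in> borel_measurable M \<Longrightarrow> (\<lambda>x. (f x :: real^'n::finite) $ i) \<in> borel_measurable M"
  by (rule measurable_compose[of f M borel]) (auto intro: borel_measurable_continuous_onI continuous_intros)

lemma lp_sum_measurable [measurable]: "lp_sum p \<in> borel_measurable borel"
  unfolding lp_sum_def[abs_def] by measurable

lemma lp_grad_measurable [measurable]: "lp_grad p \<in> borel_measurable borel"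
  unfolding lp_grad_def[abs_def] by measurable

lemma speed_measurable [measurable (raw)]:
  assumes [measurable]: "f \<in> borel_measurable M" "g \<in> borel_measurable M"
  shows "(\<lambda>x. speed p (f x) (g x)) \<in> borel_measurable M"
  unfolding speed_def by measurable

lemma flow_vec_measurable [measurable]: "flow_vec p \<tau> \<in> borel_measurable borel"
  unfolding flow_vec_def[abs_def] by measurable

section \<open>The level \<open>lp_sum\<close> along the inverse flow of a fixed point\<close>

context
  fixes p :: real
  assumes p: "1 < p"
begin

lemma speed_nonneg: "0 \<le> \<tau> \<Longrightarrow> 0 \<le> speed p \<tau> x"
  unfolding speed_def using p flow_deriv_pos[OF p] by (intro sum_nonneg) (auto intro!: divide_nonneg_pos)

lemma prox_measurable' [measurable (raw)]:
  assumes "f \<in> borel_measurable M" "g \<in> borel_measurable M"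
  shows "(\<lambda>x. prox p \<bar>f x\<bar> (g x)) \<in> borel_measurable M"
  using measurable_compose[OF measurable_Pair[OF assms] prox_measurable[OF p]] by simp

lemma prox_vec_measurable [measurable (raw)]:
  assumes [measurable]: "f \<in> borel_measurable M" "g \<in> borel_measurable M"
  shows "(\<lambda>x. prox_vec p \<bar>f x\<bar> (g x)) \<in> borel_measurable M"
  unfolding prox_vec_def by measurable

lemma prox_flow_vec: "0 \<le> \<tau> \<Longrightarrow> prox_vec p \<tau> (flow_vec p \<tau> x) = x"
  by (simp add: prox_vec_def flow_vec_def vec_eq_iff prox_flow[OF p])

lemma flow_prox_vec: "0 \<le> \<tau> \<Longrightarrow> flow_vec p \<tau> (prox_vec p \<tau> x) = x"
  by (simp add: prox_vec_def flow_vec_def vec_eq_iff flow_prox[OF p])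

lemma lp_sum_prox_vec: "0 \<le> \<tau> \<Longrightarrow> lp_sum p (prox_vec p \<tau> y) = (\<Sum>i\<in>UNIV. prox p \<tau> \<bar>y $ i\<bar> powr p)"
  by (simp add: lp_sum_def prox_vec_def abs_prox[OF p])

text \<open>Oddness of \<open>prox\<close> replaces each coordinate of \<open>y\<close> by its
  absolute value, which is positive, so that \<open>prox_has_derivative\<close> and the chain rule
  apply. This rewriting is valid for nonnegative parameters, hence the final transfer on the open
  half-line.\<close>

lemma lp_sum_prox_has_derivative:
  assumes y: "\<And>i. y $ i \<noteq> 0" and t: "0 < \<tau>"
  shows "((\<lambda>\<tau>. lp_sum p (prox_vec p \<tau> y)) has_real_derivative - speed p \<tau> (prox_vec p \<tau> y)) (at \<tau>)"
proof -
  let ?x = "\<lambda>i. prox p \<tau> \<bar>y $ i\<bar>"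
  have x: "0 < ?x i" for i using y t by (simp add: prox_pos_iff[OF p])
  have "((\<lambda>\<tau>. \<Sum>i\<in>UNIV. prox p \<tau> \<bar>y $ i\<bar> powr p) has_real_derivative
      (\<Sum>i\<in>UNIV. p * ?x i powr (p - 1) * - (?x i powr (p - 1) / flow_deriv p \<tau> (?x i)))) (at \<tau>)"
  proof (rule DERIV_sum)
    fix i
    have "((\<lambda>x. x powr p) has_real_derivative p * ?x i powr (p - 1)) (at (?x i))"
      using x by (auto intro!: derivative_eq_intros)
    then show "((\<lambda>\<tau>. prox p \<tau> \<bar>y $ i\<bar> powr p) has_real_derivative
        p * ?x i powr (p - 1) * - (?x i powr (p - 1) / flow_deriv p \<tau> (?x i))) (at \<tau>)"
      by (rule DERIV_chain2) (rule prox_has_derivative[OF p t], use y in simp)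
  qed
  also have "(\<Sum>i\<in>UNIV. p * ?x i powr (p - 1) * - (?x i powr (p - 1) / flow_deriv p \<tau> (?x i)))
     = - speed p \<tau> (prox_vec p \<tau> y)"
    unfolding speed_def sum_negf[symmetric]
  proof (rule sum.cong[OF refl])
    fix i
    have "?x i powr (p - 1) * ?x i powr (p - 1) = ?x i powr (2 * p - 2)"
      by (simp only: powr_add[symmetric]) simp
    moreover have "\<bar>prox_vec p \<tau> y $ i\<bar> = ?x i" using t by (simp add: prox_vec_def abs_prox[OF p])
    moreover have "flow_deriv p \<tau> (prox_vec p \<tau> y $ i) = flow_deriv p \<tau> (?x i)"
      using t by (simp add: prox_vec_def flow_deriv_def abs_prox[OF p])
    ultimately show "p * ?x i powr (p - 1) * - (?x i powr (p - 1) / flow_deriv p \<tau> (?x i))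
      = - (p * \<bar>prox_vec p \<tau> y $ i\<bar> powr (2 * p - 2) / flow_deriv p \<tau> (prox_vec p \<tau> y $ i))"
      by (metis (no_types, lifting) mult.assoc mult_minus_right times_divide_eq_right)
  qed
  finally show ?thesis
    by (rule has_field_derivative_transform_within_open[where S = "{0<..}"])
       (use t in \<open>auto simp: lp_sum_prox_vec\<close>)
qed

lemma lp_sum_prox_strict_antimono:
  assumes y: "\<And>i. y $ i \<noteq> 0" and t: "0 \<le> \<tau>" "\<tau> < \<tau>'"
  shows "lp_sum p (prox_vec p \<tau>' y) < lp_sum p (prox_vec p \<tau> y)"
proof -
  have "prox p \<tau>' \<bar>y $ i\<bar> powr p < prox p \<tau> \<bar>y $ i\<bar> powr p" for i
    using prox_antimono[OF p t, of "\<bar>y $ i\<bar>"] prox_pos_iff[OF p, of \<tau>' "\<bar>y $ i\<bar>"] y t p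
    by (intro powr_less_mono2) auto
  then show ?thesis using t by (simp add: lp_sum_prox_vec sum_strict_mono)
qed

text \<open>By \<open>prox_le_powr\<close> each summand is at most
  \<open>\<bar>y $ i\<bar> / \<tau>\<close> raised to the positive exponent
  \<open>p / (p - 1)\<close>.\<close>

lemma lp_sum_prox_tendsto_0:
  fixes y :: "real^'n::finite"
  assumes y: "\<And>i. y $ i \<noteq> 0"
  shows "((\<lambda>\<tau>. lp_sum p (prox_vec p \<tau> y)) \<longlongrightarrow> 0) at_top"
proof -
  have "((\<lambda>\<tau>. \<Sum>i\<in>UNIV. prox p \<tau> \<bar>y $ i\<bar> powr p) \<longlongrightarrow> (\<Sum>i\<in>(UNIV::'n set). 0)) at_top"
  proof (rule tendsto_sum)
    fix i
    have y0: "0 < \<bar>y $ i\<bar>" using y by simp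
    have "((\<lambda>\<tau>. \<bar>y $ i\<bar> / \<tau>) \<longlongrightarrow> 0) at_top"
      by (intro tendsto_divide_0[OF tendsto_const] filterlim_at_top_imp_at_infinity filterlim_ident)
    then have "((\<lambda>\<tau>. (\<bar>y $ i\<bar> / \<tau>) powr (p / (p - 1))) \<longlongrightarrow> 0) at_top"
      using p by (intro tendsto_zero_powrI[OF _ tendsto_const])
         (auto intro!: always_eventually eventually_mono[OF eventually_gt_at_top[of 0]])
    then show "((\<lambda>\<tau>. prox p \<tau> \<bar>y $ i\<bar> powr p) \<longlongrightarrow> 0) at_top"
    proof (rule tendsto_sandwich[OF _ _ tendsto_const, rotated -1])
      show "\<forall>\<^sub>F \<tau> in at_top. prox p \<tau> \<bar>y $ i\<bar> powr p \<le> (\<bar>y $ i\<bar> / \<tau>) powr (p / (p - 1))"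
        using eventually_gt_at_top[of 0]
      proof eventually_elim
        case (elim \<tau>)
        have "prox p \<tau> \<bar>y $ i\<bar> powr p \<le> ((\<bar>y $ i\<bar> / \<tau>) powr (1 / (p - 1))) powr p"
          using prox_le_powr[OF p elim y0] prox_pos_iff[OF p, of \<tau> "\<bar>y $ i\<bar>"] elim y0 p
          by (intro powr_mono2) auto
        then show ?case by (simp add: powr_powr)
      qed
    qed auto
  qed
  then have "((\<lambda>\<tau>. \<Sum>i\<in>UNIV. prox p \<tau> \<bar>y $ i\<bar> powr p) \<longlongrightarrow> 0) at_top"
    by simp
  moreover have "\<forall>\<^sub>F \<tau> in at_top. (\<Sum>i\<in>UNIV. prox p \<tau> \<bar>y $ i\<bar> powr p) = lp_sum p (prox_vec p \<tau> y)"
    using eventually_ge_at_top[of "0::real"] by eventually_elim (simp add: lp_sum_prox_vec)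
  ultimately show ?thesis
    by (simp cong: tendsto_cong)
qed

lemma lp_sum_prox_tendsto_at_0:
  assumes y: "\<And>i. y $ i \<noteq> 0"
  shows "((\<lambda>\<tau>. lp_sum p (prox_vec p \<tau> y)) \<longlongrightarrow> lp_sum p y) (at_right 0)"
proof -
  have "((\<lambda>\<tau>. \<Sum>i\<in>UNIV. prox p \<tau> \<bar>y $ i\<bar> powr p) \<longlongrightarrow> (\<Sum>i\<in>UNIV. \<bar>y $ i\<bar> powr p)) (at_right 0)"
  proof (intro tendsto_sum tendsto_powr[OF _ tendsto_const])
    fix i
    have y0: "0 < \<bar>y $ i\<bar>" using y by simp
    show "((\<lambda>\<tau>. prox p \<tau> \<bar>y $ i\<bar>) \<longlongrightarrow> \<bar>y $ i\<bar>) (at_right 0)"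
    proof (rule tendsto_sandwich[OF _ _ _ tendsto_const])
      show "\<forall>\<^sub>F \<tau> in at_right 0. \<bar>y $ i\<bar> - \<tau> * \<bar>y $ i\<bar> powr (p - 1) \<le> prox p \<tau> \<bar>y $ i\<bar>"
        using eventually_at_right_less[of 0] by eventually_elim (use prox_ge[OF p] y0 in simp)
      show "\<forall>\<^sub>F \<tau> in at_right 0. prox p \<tau> \<bar>y $ i\<bar> \<le> \<bar>y $ i\<bar>"
        using eventually_at_right_less[of 0] by eventually_elim (use prox_le[OF p] y0 in simp)
      show "((\<lambda>\<tau>. \<bar>y $ i\<bar> - \<tau> * \<bar>y $ i\<bar> powr (p - 1)) \<longlongrightarrow> \<bar>y $ i\<bar>) (at_right 0)"
        by (auto intro!: tendsto_eq_intros)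
    qed
    show "\<bar>y $ i\<bar> \<noteq> 0" using y by simp
  qed
  then show ?thesis unfolding lp_sum_def[of p y, symmetric]
    by (rule tendsto_cong[THEN iffD1, rotated])
       (use eventually_at_right_less[of 0] in \<open>auto elim!: eventually_mono simp: lp_sum_prox_vec\<close>)
qed

text \<open>Strict decrease from the value \<open>lp_sum p y\<close> at \<open>\<tau> = 0\<close>
  keeps the values inside the open interval. Each of its points is attained by the intermediate
  value theorem between a small and a large positive parameter, which the limits at \<open>0\<close>
  and at infinity supply.\<close>

lemma lp_sum_prox_image:
  fixes y :: "real^'n::finite"
  assumes y: "\<And>i. y $ i \<noteq> 0"
  shows "(\<lambda>\<tau>. lp_sum p (prox_vec p \<tau> y)) ` {0<..} = {0<..<lp_sum p y}" (is "?s ` _ = _")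
proof (intro equalityI subsetI)
  have s0: "?s 0 = lp_sum p y" by (simp add: prox_vec_def prox_tau_0[OF p])
  fix s assume "s \<in> ?s ` {0<..}"
  then obtain \<tau> where t: "0 < \<tau>" "s = ?s \<tau>" by auto
  have "prox_vec p \<tau> y \<noteq> 0" using t y by (simp add: prox_vec_def vec_eq_iff prox_eq_0_iff[OF p])
  then show "s \<in> {0<..<lp_sum p y}"
    using lp_sum_pos lp_sum_prox_strict_antimono[OF y, of 0 \<tau>] t s0 by auto
next
  fix s assume s: "s \<in> {0<..<lp_sum p y}"
  have "\<forall>\<^sub>F \<tau> in at_right 0. s < ?s \<tau>"
    using s by (intro order_tendstoD(1)[OF lp_sum_prox_tendsto_at_0[OF y]]) auto
  then obtain b where b: "0 < b" "\<And>\<tau>. 0 < \<tau> \<Longrightarrow> \<tau> < b \<Longrightarrow> s < ?s \<tau>"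
    by (auto simp: eventually_at_right_field)
  define \<tau>1 where "\<tau>1 = b / 2"
  have t1: "0 < \<tau>1" "s < ?s \<tau>1" using b by (auto simp: \<tau>1_def)
  have "\<forall>\<^sub>F \<tau> in at_top. ?s \<tau> < s \<and> \<tau>1 \<le> \<tau>"
    using s by (intro eventually_conj order_tendstoD(2)[OF lp_sum_prox_tendsto_0[OF y]] eventually_ge_at_top) auto
  then obtain \<tau>2 where t2: "?s \<tau>2 < s" "\<tau>1 \<le> \<tau>2"
    by (auto simp: eventually_at_top_linorder)
  have "\<exists>\<tau>\<ge>\<tau>1. \<tau> \<le> \<tau>2 \<and> ?s \<tau> = s"
    using t1 t2 DERIV_isCont[OF lp_sum_prox_has_derivative[OF y]]
    by (intro IVT2) auto
  then show "s \<in> ?s ` {0<..}" using t1 by force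
qed

lemma nn_integral_lp_sum_prox:
  fixes y :: "real^'n::finite"
  assumes y: "\<And>i. y $ i \<noteq> 0" and f [measurable]: "f \<in> borel_measurable borel" and f0: "\<And>s. 0 \<le> f s"
  shows "(\<integral>\<^sup>+s. ennreal (indicator {0<..<lp_sum p y} s * f s) \<partial>lborel)
    = (\<integral>\<^sup>+\<tau>. ennreal (indicator {0<..} \<tau> * (speed p \<tau> (prox_vec p \<tau> y) * f (lp_sum p (prox_vec p \<tau> y)))) \<partial>lborel)"
proof -
  let ?s = "\<lambda>\<tau>. lp_sum p (prox_vec p \<tau> y)" and ?v = "\<lambda>\<tau>. - speed p \<tau> (prox_vec p \<tau> y)"
  \<comment> \<open>Measurability of \<open>prox_vec\<close> in the parameter was shown for
    \<open>\<bar>\<tau>\<bar>\<close>; the indicator of \<open>{0<..}\<close> permits the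
    replacement.\<close>
  have e: "indicator {0<..} \<tau> * (\<bar>?v \<tau>\<bar> * f (?s \<tau>))
      = indicator {0<..} \<tau> * (\<bar>speed p \<tau> (prox_vec p \<bar>\<tau>\<bar> y)\<bar> * f (lp_sum p (prox_vec p \<bar>\<tau>\<bar> y)))" for \<tau>
    by (simp add: indicator_def)
  have "(\<integral>\<^sup>+s. ennreal (indicator (?s ` {0<..}) s * f s) \<partial>lborel)
      = (\<integral>\<^sup>+\<tau>. ennreal (indicator {0<..} \<tau> * (\<bar>?v \<tau>\<bar> * f (?s \<tau>))) \<partial>lborel)"
  proof (rule nn_integral_subst_real)
    show "inj_on ?s {0<..}"
      using lp_sum_prox_strict_antimono[OF y] by (intro inj_onI) (metis greaterThan_iff less_irrefl less_le linorder_cases)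
    show "?s ` {0<..} \<in> sets borel" unfolding lp_sum_prox_image[OF y] by simp
    show "(\<lambda>\<tau>. indicator {0<..} \<tau> * (\<bar>?v \<tau>\<bar> * f (?s \<tau>))) \<in> borel_measurable borel"
      unfolding e by measurable
    show "(?s has_real_derivative ?v \<tau>) (at \<tau> within {0<..})" if "\<tau> \<in> {0<..}" for \<tau>
      using lp_sum_prox_has_derivative[OF y, of \<tau>] that by (auto intro: has_field_derivative_at_within)
  qed (use f0 in auto)
  also have "\<dots> = (\<integral>\<^sup>+\<tau>. ennreal (indicator {0<..} \<tau> * (speed p \<tau> (prox_vec p \<tau> y) * f (?s \<tau>))) \<partial>lborel)"
    by (intro nn_integral_cong) (auto simp: indicator_def speed_nonneg)
  finally show ?thesis unfolding lp_sum_prox_image[OF y] .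
qed

end

section \<open>The volume of a parallel body\<close>

lemma nn_integral_scaleR_vec:
  fixes \<Phi> :: "real^'n::finite \<Rightarrow> ennreal"
  assumes [measurable]: "\<Phi> \<in> borel_measurable borel" and c: "0 < c"
  shows "(\<integral>\<^sup>+x. \<Phi> x \<partial>lborel) = ennreal (c ^ CARD('n)) * (\<integral>\<^sup>+x. \<Phi> (c *\<^sub>R x) \<partial>lborel)"
proof -
  have "(\<integral>\<^sup>+x. \<Phi> x \<partial>lborel) = (\<integral>\<^sup>+x. \<Phi> x \<partial>density (distr lborel borel (\<lambda>x. 0 + c *\<^sub>R x)) (\<lambda>_. \<bar>c\<bar> ^ DIM(real^'n)))"
    using c by (subst lborel_affine[of c 0]) auto
  also have "\<dots> = (\<integral>\<^sup>+x. ennreal (c ^ CARD('n)) * \<Phi> (c *\<^sub>R x) \<partial>lborel)"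
    using c by (simp add: nn_integral_density nn_integral_distr)
  finally show ?thesis by (simp add: nn_integral_cmult)
qed

lemma nn_integral_lborel_swap:
  fixes f :: "'a::euclidean_space \<Rightarrow> 'b::euclidean_space \<Rightarrow> ennreal"
  assumes "(\<lambda>z. f (fst z) (snd z)) \<in> borel_measurable (borel \<Otimes>\<^sub>M borel)"
  shows "(\<integral>\<^sup>+x. \<integral>\<^sup>+y. f x y \<partial>lborel \<partial>lborel) = (\<integral>\<^sup>+y. \<integral>\<^sup>+x. f x y \<partial>lborel \<partial>lborel)"
proof -
  have "(\<lambda>(x, y). f x y) \<in> borel_measurable (lborel \<Otimes>\<^sub>M lborel)"
    using assms by (simp add: case_prod_beta cong: measurable_cong_sets)
  then show ?thesis using lborel_pair.Fubini'[of f] by simp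
qed

text \<open>What remains under the integral once \<open>s\<close> is replaced by
  \<open>\<tau>\<close>: \<open>speed\<close> is the Jacobian of that substitution, and the cutoff
  is membership in the dilated parallel body, in the form given by
  \<open>scaled_normal_point_in_parallel_iff\<close>.\<close>

definition parallel_density :: "real \<Rightarrow> real \<Rightarrow> real ^ 'n::finite \<Rightarrow> real \<Rightarrow> real" where
  "parallel_density p t x \<tau> = indicator {0<..} \<tau> * (speed p \<tau> x *
     (exp (- lp_sum p x) * (if \<tau> * norm (lp_grad p x) \<le> t * lp_sum p x powr (1 / p) then 1 else 0)))"

lemma parallel_density_measurable [measurable (raw)]:
  assumes [measurable]: "f \<in> borel_measurable M" "g \<in> borel_measurable M"
  shows "(\<lambda>x. parallel_density p t (f x) (g x)) \<in> borel_measurable M"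
  unfolding parallel_density_def by measurable

lemma nn_integral_flow_vec:
  fixes \<Phi> :: "real^'n::finite \<Rightarrow> ennreal"
  assumes p: "1 < p" and t: "0 \<le> \<tau>" and [measurable]: "\<Phi> \<in> borel_measurable borel"
  shows "(\<integral>\<^sup>+y. \<Phi> y \<partial>lborel)
    = (\<integral>\<^sup>+x. ennreal (\<Prod>i\<in>UNIV. flow_deriv p \<tau> (x $ i)) * \<Phi> (flow_vec p \<tau> x) \<partial>lborel)"
proof -
  have eq: "lborel = distr (density lborel (\<lambda>x::real^'n. ennreal (\<Prod>i\<in>UNIV. flow_deriv p \<tau> (x $ i)))) borel (flow_vec p \<tau>)"
    using lborel_flow[OF p t, where 'n = 'n] unfolding flow_vec_def[abs_def] .
  show ?thesis
    by (subst eq, subst nn_integral_distr, simp, simp, subst nn_integral_density) auto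
qed

text \<open>For almost every \<open>y\<close>, namely when no coordinate vanishes, \<open>s\<close>
  is replaced by \<open>\<tau>\<close>. After an exchange of integrals \<open>\<tau>\<close> is
  fixed, and the substitution \<open>y = flow_vec p \<tau> x\<close> cancels
  \<open>prox_vec\<close>; a second exchange restores the order.\<close>

lemma parallel_volume_flow:
  assumes p: "1 < p" and t: "0 \<le> t"
  shows "(\<integral>\<^sup>+y. \<integral>\<^sup>+s. ennreal (indicator {0<..<lp_sum p y} s *
        (exp (- s) * indicator (lp_parallel p t) ((1 / s powr (1 / p)) *\<^sub>R y))) \<partial>lborel \<partial>(lborel :: (real^'n::finite) measure))
    = (\<integral>\<^sup>+x. \<integral>\<^sup>+\<tau>. ennreal ((\<Prod>i\<in>UNIV. flow_deriv p \<tau> (x $ i)) * parallel_density p t x \<tau>) \<partial>lborel \<partial>(lborel :: (real^'n) measure))"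
  (is "?L = ?R")
proof -
  note [measurable] = prox_vec_measurable[OF p]
  have [measurable]: "lp_parallel p t \<in> sets (borel :: (real^'n) measure)"
    using compact_lp_parallel[of p t] p by (auto intro: borel_compact)
  have prox: "(\<integral>\<^sup>+s. ennreal (indicator {0<..<lp_sum p y} s *
        (exp (- s) * indicator (lp_parallel p t) ((1 / s powr (1 / p)) *\<^sub>R y))) \<partial>lborel)
     = (\<integral>\<^sup>+\<tau>. ennreal (parallel_density p t (prox_vec p \<bar>\<tau>\<bar> y) \<tau>) \<partial>lborel)"
    if y: "\<And>i. y $ i \<noteq> 0" for y :: "real^'n"
  proof -
    have "indicator {0<..} \<tau> * (speed p \<tau> (prox_vec p \<tau> y) * (exp (- lp_sum p (prox_vec p \<tau> y)) *
         indicator (lp_parallel p t) ((1 / lp_sum p (prox_vec p \<tau> y) powr (1 / p)) *\<^sub>R y)))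
       = parallel_density p t (prox_vec p \<bar>\<tau>\<bar> y) \<tau>" for \<tau>
    proof (cases "0 < \<tau>")
      case True
      have "prox_vec p \<tau> y \<noteq> 0"
        using True y by (simp add: prox_vec_def vec_eq_iff prox_eq_0_iff[OF p])
      from scaled_normal_point_in_parallel_iff[OF p this _ t, of \<tau>]
      show ?thesis using True flow_prox_vec[OF p, of \<tau> y]
        by (simp add: parallel_density_def flow_vec_eq indicator_def)
    qed (simp add: parallel_density_def)
    moreover have "(\<lambda>s. exp (- s) * indicator (lp_parallel p t) ((1 / s powr (1 / p)) *\<^sub>R y) :: real) \<in> borel_measurable borel"
      by measurable
    ultimately show ?thesis
      using nn_integral_lp_sum_prox[OF p y, of "\<lambda>s. exp (- s) * indicator (lp_parallel p t) ((1 / s powr (1 / p)) *\<^sub>R y)"]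
      by simp
  qed
  have "?L = (\<integral>\<^sup>+y. \<integral>\<^sup>+\<tau>. ennreal (parallel_density p t (prox_vec p \<bar>\<tau>\<bar> y) \<tau>) \<partial>lborel \<partial>(lborel :: (real^'n) measure))"
    using AE_lborel_vec_neq[of 0] by (intro nn_integral_cong_AE) (auto elim!: eventually_mono simp: prox)
  also have "\<dots> = (\<integral>\<^sup>+\<tau>. \<integral>\<^sup>+y. ennreal (parallel_density p t (prox_vec p \<bar>\<tau>\<bar> y) \<tau>) \<partial>(lborel :: (real^'n) measure) \<partial>lborel)"
    by (rule nn_integral_lborel_swap) measurable
  also have "\<dots> = (\<integral>\<^sup>+\<tau>. \<integral>\<^sup>+x. ennreal ((\<Prod>i\<in>UNIV. flow_deriv p \<tau> (x $ i)) * parallel_density p t x \<tau>) \<partial>(lborel :: (real^'n) measure) \<partial>lborel)"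
  proof (rule nn_integral_cong)
    fix \<tau> :: real
    show "(\<integral>\<^sup>+y. ennreal (parallel_density p t (prox_vec p \<bar>\<tau>\<bar> y) \<tau>) \<partial>(lborel :: (real^'n) measure))
      = (\<integral>\<^sup>+x. ennreal ((\<Prod>i\<in>UNIV. flow_deriv p \<tau> (x $ i)) * parallel_density p t x \<tau>) \<partial>(lborel :: (real^'n) measure))"
    proof (cases "0 < \<tau>")
      case True
      then have t0: "0 \<le> \<tau>" by simp
      have "(\<integral>\<^sup>+y. ennreal (parallel_density p t (prox_vec p \<bar>\<tau>\<bar> y) \<tau>) \<partial>(lborel :: (real^'n) measure))
        = (\<integral>\<^sup>+x. ennreal (\<Prod>i\<in>UNIV. flow_deriv p \<tau> (x $ i)) *
            ennreal (parallel_density p t (prox_vec p \<bar>\<tau>\<bar> (flow_vec p \<tau> x)) \<tau>) \<partial>(lborel :: (real^'n) measure))"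
        by (rule nn_integral_flow_vec[OF p t0]) measurable
      also have "\<dots> = (\<integral>\<^sup>+x. ennreal ((\<Prod>i\<in>UNIV. flow_deriv p \<tau> (x $ i)) * parallel_density p t x \<tau>) \<partial>(lborel :: (real^'n) measure))"
        using flow_deriv_pos[OF p t0] True
        by (intro nn_integral_cong, subst ennreal_mult'[symmetric])
           (auto intro!: prod_nonneg simp: less_imp_le prox_flow_vec[OF p])
      finally show ?thesis .
    qed (simp add: parallel_density_def)
  qed
  also have "\<dots> = ?R"
    by (rule nn_integral_lborel_swap[symmetric]) measurable
  finally show ?thesis .
qed

lemma nn_integral_exp_powr:
  assumes "0 < a"
  shows "(\<integral>\<^sup>+s. ennreal (indicator {0<..} s * (exp (- s) * s powr (a - 1))) \<partial>lborel) = ennreal (Gamma a)"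
  unfolding Gamma_conv_nn_integral_real[OF assms]
  by (intro nn_integral_cong) (auto simp: indicator_def exp_minus field_simps)

text \<open>The left side of \<open>parallel_volume_flow\<close>, integrated first over
  \<open>y\<close>. For fixed \<open>s > 0\<close> the dilation \<open>y = s^(1/p) z\<close> turns
  the section into the parallel body minus the ball, with Jacobian \<open>s^(n/p)\<close>;
  integration against \<open>exp (- s)\<close> then gives \<open>Gamma (1 + n / p)\<close>.\<close>

lemma parallel_volume_layers:
  assumes p: "1 < p" and t: "0 \<le> t"
  shows "(\<integral>\<^sup>+y. \<integral>\<^sup>+s. ennreal (indicator {0<..<lp_sum p y} s *
        (exp (- s) * indicator (lp_parallel p t) ((1 / s powr (1 / p)) *\<^sub>R y))) \<partial>lborel \<partial>(lborel :: (real^'n::finite) measure))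
    = ennreal (Gamma (1 + real CARD('n) / p) *
        (measure lebesgue (lp_parallel p t :: (real^'n) set) - measure lebesgue (lp_ball p :: (real^'n) set)))"
  (is "?L = _")
proof -
  have P: "compact (lp_parallel p t :: (real^'n) set)" and K: "compact (lp_ball p :: (real^'n) set)"
    using compact_lp_parallel[of p t] compact_lp_ball[of p] p by auto
  have [measurable]: "lp_parallel p t \<in> sets (borel :: (real^'n) measure)"
    "lp_ball p \<in> sets (borel :: (real^'n) measure)"
    using P K by (auto intro: borel_compact)
  define v where "v = measure lebesgue (lp_parallel p t :: (real^'n) set) - measure lebesgue (lp_ball p :: (real^'n) set)"
  let ?D = "lp_parallel p t - lp_ball p :: (real^'n) set"
  have fin: "emeasure lborel (lp_ball p :: (real^'n) set) < \<infinity>" "emeasure lborel (lp_parallel p t :: (real^'n) set) < \<infinity>"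
    using K P emeasure_bounded_finite[OF compact_imp_bounded] by blast+
  have meas: "measure lebesgue X = measure lborel X" if "X \<in> sets borel" for X :: "(real^'n) set"
    using that by (simp add: measure_completion)
  have vD: "emeasure lborel ?D = ennreal v"
  proof -
    have "emeasure lborel ?D = emeasure lborel (lp_parallel p t :: (real^'n) set) - emeasure lborel (lp_ball p :: (real^'n) set)"
      using fin lp_ball_subset_parallel by (intro emeasure_Diff) auto
    also have "\<dots> = ennreal v" unfolding v_def
      using fin by (simp add: meas emeasure_eq_ennreal_measure ennreal_minus)
    finally show ?thesis .
  qed
  have v0: "0 \<le> v"
  proof -
    have "measure lborel (lp_ball p :: (real^'n) set) \<le> measure lborel (lp_parallel p t :: (real^'n) set)"
      by (rule measure_mono_fmeasurable) (use fin lp_ball_subset_parallel in \<open>auto intro: fmeasurableI\<close>)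
    then show ?thesis by (simp add: v_def meas)
  qed
  \<comment> \<open>The interval depends on \<open>y\<close>; written as a conditional, its
    indicator is visibly measurable in \<open>y\<close> and \<open>s\<close> jointly.\<close>
  have ind: "indicator {0<..<b} a = (if 0 < a \<and> a < b then 1 else 0 :: real)" for a b :: real
    by simp
  have inner: "(\<integral>\<^sup>+y. ennreal (indicator {0<..<lp_sum p y} s *
        (exp (- s) * indicator (lp_parallel p t) ((1 / s powr (1 / p)) *\<^sub>R y))) \<partial>(lborel :: (real^'n) measure))
      = ennreal (indicator {0<..} s * (exp (- s) * s powr (1 + real CARD('n) / p - 1))) * ennreal v" for s
  proof (cases "0 < s")
    case True
    define c where "c = s powr (1 / p)"
    have c: "0 < c" using True by (simp add: c_def)
    have cp: "c powr p = s" using True p by (simp add: c_def powr_powr)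
    have cn: "c ^ CARD('n) = s powr (real CARD('n) / p)"
      using c True by (simp add: powr_realpow[symmetric] c_def powr_powr)
    have ball: "s < lp_sum p (c *\<^sub>R y) \<longleftrightarrow> y \<notin> lp_ball p" for y :: "real^'n"
      using c True by (simp add: lp_sum_scaleR cp lp_ball_eq not_le)
    have "(\<integral>\<^sup>+y. ennreal (indicator {0<..<lp_sum p y} s *
        (exp (- s) * indicator (lp_parallel p t) ((1 / c) *\<^sub>R y))) \<partial>(lborel :: (real^'n) measure))
      = ennreal (c ^ CARD('n)) * (\<integral>\<^sup>+y. ennreal (indicator {0<..<lp_sum p (c *\<^sub>R y)} s *
        (exp (- s) * indicator (lp_parallel p t) ((1 / c) *\<^sub>R (c *\<^sub>R y)))) \<partial>(lborel :: (real^'n) measure))"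
      by (rule nn_integral_scaleR_vec[OF _ c]) (unfold ind, measurable)
    also have "(\<integral>\<^sup>+y. ennreal (indicator {0<..<lp_sum p (c *\<^sub>R y)} s *
        (exp (- s) * indicator (lp_parallel p t) ((1 / c) *\<^sub>R (c *\<^sub>R y)))) \<partial>(lborel :: (real^'n) measure))
      = (\<integral>\<^sup>+y. ennreal (exp (- s)) * indicator ?D y \<partial>lborel)"
      using True c by (intro nn_integral_cong) (auto simp: indicator_def ball)
    also have "\<dots> = ennreal (exp (- s)) * ennreal v" by (simp add: nn_integral_cmult vD)
    finally show ?thesis using True v0
      by (simp add: c_def[symmetric] cn ennreal_mult'[symmetric] mult_ac)
  qed (simp add: indicator_def)
  have "?L = (\<integral>\<^sup>+s. \<integral>\<^sup>+y. ennreal (indicator {0<..<lp_sum p y} s *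
        (exp (- s) * indicator (lp_parallel p t) ((1 / s powr (1 / p)) *\<^sub>R y))) \<partial>(lborel :: (real^'n) measure) \<partial>lborel)"
    by (rule nn_integral_lborel_swap) (unfold ind, measurable)
  also have "\<dots> = ennreal (Gamma (1 + real CARD('n) / p)) * ennreal v"
    unfolding inner
    by (subst nn_integral_multc, simp, subst nn_integral_exp_powr) (use p in \<open>auto simp: add_pos_nonneg\<close>)
  also have "\<dots> = ennreal (Gamma (1 + real CARD('n) / p) * v)"
    using p by (intro ennreal_mult'[symmetric] less_imp_le Gamma_real_pos) (auto simp: add_pos_nonneg)
  finally show ?thesis unfolding v_def .
qed

section \<open>Homogeneous integrands\<close>

lemma nn_integral_scale_real:
  fixes f :: "real \<Rightarrow> real"
  assumes [measurable]: "f \<in> borel_measurable borel" and c: "0 < c"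
  shows "(\<integral>\<^sup>+x. ennreal (indicator {0<..} x * f x) \<partial>lborel) = (\<integral>\<^sup>+x. ennreal (indicator {0<..} x * (c * f (c * x))) \<partial>lborel)"
proof -
  have "(\<integral>\<^sup>+x. ennreal (indicator {0<..} x * f x) \<partial>lborel)
      = ennreal \<bar>c\<bar> * (\<integral>\<^sup>+x. ennreal (indicator {0<..} (0 + c * x) * f (0 + c * x)) \<partial>lborel)"
    by (rule nn_integral_real_affine) (use c in auto)
  also have "\<dots> = (\<integral>\<^sup>+x. ennreal \<bar>c\<bar> * ennreal (indicator {0<..} (0 + c * x) * f (0 + c * x)) \<partial>lborel)"
    by (rule nn_integral_cmult[symmetric]) measurable
  also have "\<dots> = (\<integral>\<^sup>+x. ennreal (indicator {0<..} x * (c * f (c * x))) \<partial>lborel)"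
    using c by (intro nn_integral_cong, subst ennreal_mult'[symmetric])
      (auto simp: indicator_def zero_less_mult_iff)
  finally show ?thesis .
qed

lemma nn_integral_invert_real:
  fixes f :: "real \<Rightarrow> real"
  assumes [measurable]: "f \<in> borel_measurable borel" and f0: "\<And>x. 0 \<le> f x" and c: "0 < c"
  shows "(\<integral>\<^sup>+x. ennreal (indicator {0<..} x * f x) \<partial>lborel)
      = (\<integral>\<^sup>+x. ennreal (indicator {0<..} x * (c / x\<^sup>2 * f (c / x))) \<partial>lborel)"
proof -
  have im: "(\<lambda>x. c / x) ` {0<..} = {0<..}"
  proof (intro equalityI subsetI)
    fix y :: real assume "y \<in> {0<..}"
    then show "y \<in> (\<lambda>x. c / x) ` {0<..}" using c by (intro image_eqI[of _ _ "c / y"]) auto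
  qed (use c in auto)
  have "(\<integral>\<^sup>+x. ennreal (indicator ((\<lambda>x. c / x) ` {0<..}) x * f x) \<partial>lborel)
      = (\<integral>\<^sup>+x. ennreal (indicator {0<..} x * (\<bar>- (c / x\<^sup>2)\<bar> * f (c / x))) \<partial>lborel)"
  proof (rule nn_integral_subst_real)
    show "((\<lambda>x. c / x) has_real_derivative - (c / x\<^sup>2)) (at x within {0<..})" if "x \<in> {0<..}" for x
      using that by (auto intro!: derivative_eq_intros simp: power2_eq_square)
    show "inj_on (\<lambda>x. c / x) {0<..}" using c by (auto simp: inj_on_def)
  qed (use f0 im in auto)
  then show ?thesis unfolding im using c by simp
qed

text \<open>Both sides are compared after the substitutions \<open>s = v f(x)\<close> and \<open>s = f(x) / v\<close>,
  \<open>f\<close> being \<open>lp_sum p\<close>; the dilation of space by \<open>v\<close> to the power \<open>-1/p\<close> then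
  exchanges the roles of \<open>\<phi>\<close> and \<open>\<psi>\<close>.\<close>
lemma homogeneous_integral_exchange:
  fixes h :: "real^'n::finite \<Rightarrow> real" and \<phi> \<psi> :: "real \<Rightarrow> real"
  assumes p: "1 < p"
    and [measurable]: "h \<in> borel_measurable borel" "\<phi> \<in> borel_measurable borel" "\<psi> \<in> borel_measurable borel"
    and h0: "\<And>x. 0 \<le> h x" and \<phi>0: "\<And>s. 0 \<le> \<phi> s" and \<psi>0: "\<And>s. 0 \<le> \<psi> s"
    and hom: "\<And>c x. 0 < c \<Longrightarrow> h (c *\<^sub>R x) = c powr d * h x"
  defines "D \<equiv> (real CARD('n) + d) / p"
  shows "(\<integral>\<^sup>+x. ennreal (\<psi> (lp_sum p x) * h x) \<partial>lborel) * (\<integral>\<^sup>+s. ennreal (indicator {0<..} s * (\<phi> s * s powr (D - 1))) \<partial>lborel)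
    = (\<integral>\<^sup>+x. ennreal (\<phi> (lp_sum p x) * h x) \<partial>lborel) * (\<integral>\<^sup>+s. ennreal (indicator {0<..} s * (\<psi> s * s powr (D - 1))) \<partial>lborel)"
proof -
  have AE0: "AE x in (lborel :: (real^'n) measure). x \<noteq> 0" by (rule AE_lborel_singleton)
  define F where "F x v = indicator {0<..} v * (\<psi> (lp_sum p x) * h x * lp_sum p x powr D * (v powr (D - 1) * \<phi> (lp_sum p x * v)))" for x :: "real^'n" and v
  define G where "G x v = indicator {0<..} v * (\<phi> (lp_sum p x) * h x * lp_sum p x powr D * (v powr (- D - 1) * \<psi> (lp_sum p x / v)))" for x :: "real^'n" and v
  have Fm: "(\<lambda>z. F (fst z) (snd z)) \<in> borel_measurable (borel \<Otimes>\<^sub>M borel)"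
    unfolding F_def by measurable
  have Gm: "(\<lambda>z. G (fst z) (snd z)) \<in> borel_measurable (borel \<Otimes>\<^sub>M borel)"
    unfolding G_def by measurable
  have "(\<integral>\<^sup>+x. ennreal (\<psi> (lp_sum p x) * h x) \<partial>lborel) * (\<integral>\<^sup>+s. ennreal (indicator {0<..} s * (\<phi> s * s powr (D - 1))) \<partial>lborel)
     = (\<integral>\<^sup>+x. ennreal (\<psi> (lp_sum p x) * h x) * (\<integral>\<^sup>+s. ennreal (indicator {0<..} s * (\<phi> s * s powr (D - 1))) \<partial>lborel) \<partial>lborel)"
    by (rule nn_integral_multc[symmetric]) measurable
  also have "\<dots> = (\<integral>\<^sup>+x. \<integral>\<^sup>+v. ennreal (F x v) \<partial>lborel \<partial>lborel)"
  proof (rule nn_integral_cong_AE, use AE0 in eventually_elim)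
    fix x :: "real^'n" assume "x \<noteq> 0"
    then have f: "0 < lp_sum p x" by (rule lp_sum_pos)
    have "(\<integral>\<^sup>+s. ennreal (indicator {0<..} s * (\<phi> s * s powr (D - 1))) \<partial>lborel)
      = (\<integral>\<^sup>+s. ennreal (indicator {0<..} s * (lp_sum p x * (\<phi> (lp_sum p x * s) * (lp_sum p x * s) powr (D - 1)))) \<partial>lborel)"
      by (rule nn_integral_scale_real[OF _ f]) measurable
    then have "ennreal (\<psi> (lp_sum p x) * h x) * (\<integral>\<^sup>+s. ennreal (indicator {0<..} s * (\<phi> s * s powr (D - 1))) \<partial>lborel)
      = (\<integral>\<^sup>+s. ennreal (\<psi> (lp_sum p x) * h x) * ennreal (indicator {0<..} s * (lp_sum p x * (\<phi> (lp_sum p x * s) * (lp_sum p x * s) powr (D - 1)))) \<partial>lborel)"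
      by (simp add: nn_integral_cmult)
    also have "\<dots> = (\<integral>\<^sup>+v. ennreal (F x v) \<partial>lborel)"
    proof (rule nn_integral_cong)
      fix v :: real
      have eq: "lp_sum p x * (lp_sum p x * v) powr (D - 1) = lp_sum p x powr D * v powr (D - 1)" if "0 < v"
        using f that by (simp add: powr_mult powr_diff)
      have eq2: "\<psi> (lp_sum p x) * h x * (lp_sum p x * (\<phi> (lp_sum p x * v) * (lp_sum p x * v) powr (D - 1)))
          = \<psi> (lp_sum p x) * h x * lp_sum p x powr D * (v powr (D - 1) * \<phi> (lp_sum p x * v))" if "0 < v"
        using arg_cong[OF eq[OF that], of "\<lambda>z. \<psi> (lp_sum p x) * h x * \<phi> (lp_sum p x * v) * z"]
        by (simp only: mult_ac)
      show "ennreal (\<psi> (lp_sum p x) * h x) * ennreal (indicator {0<..} v * (lp_sum p x * (\<phi> (lp_sum p x * v) * (lp_sum p x * v) powr (D - 1)))) = ennreal (F x v)"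
        using h0[of x] \<psi>0 by (subst ennreal_mult'[symmetric]) (auto simp: F_def indicator_def eq2)
    qed
    finally show "ennreal (\<psi> (lp_sum p x) * h x) * (\<integral>\<^sup>+s. ennreal (indicator {0<..} s * (\<phi> s * s powr (D - 1))) \<partial>lborel)
       = (\<integral>\<^sup>+v. ennreal (F x v) \<partial>lborel)" .
  qed
  also have "\<dots> = (\<integral>\<^sup>+v. \<integral>\<^sup>+x. ennreal (F x v) \<partial>lborel \<partial>lborel)"
    by (rule nn_integral_lborel_swap) (use Fm in measurable)
  also have "\<dots> = (\<integral>\<^sup>+v. \<integral>\<^sup>+x. ennreal (G x v) \<partial>lborel \<partial>lborel)"
  proof (rule nn_integral_cong)
    fix v :: real
    show "(\<integral>\<^sup>+x. ennreal (F x v) \<partial>lborel) = (\<integral>\<^sup>+x. ennreal (G x v) \<partial>lborel)"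
    proof (cases "0 < v")
      case True
      define c where "c = v powr (- 1 / p)"
      have c: "0 < c" using True by (simp add: c_def)
      have cp: "c powr p = 1 / v" using True p unfolding c_def powr_powr by (simp add: powr_neg_one)
      \<comment> \<open>The Jacobian has degree \<open>n\<close> and \<open>h\<close> has degree
        \<open>d\<close>; their sum is \<open>p * D\<close>, so a dilation by
        \<open>v powr (- 1 / p)\<close> costs exactly \<open>v powr (- D)\<close>.\<close>
      have cnd: "c ^ CARD('n) * c powr d = v powr (- D)"
      proof -
        have "c ^ CARD('n) * c powr d = c powr (real CARD('n) + d)"
          using c by (simp add: powr_realpow powr_add)
        also have "\<dots> = v powr (- D)" unfolding c_def powr_powr D_def by simp
        finally show ?thesis .
      qed
      have lf: "lp_sum p (c *\<^sub>R x) = lp_sum p x / v" for x :: "real^'n"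
        using c by (simp add: lp_sum_scaleR cp)
      have [measurable]: "(\<lambda>x. F x v) \<in> borel_measurable borel"
        unfolding F_def by measurable
      have "(\<integral>\<^sup>+x. ennreal (F x v) \<partial>lborel) = ennreal (c ^ CARD('n)) * (\<integral>\<^sup>+x. ennreal (F (c *\<^sub>R x) v) \<partial>lborel)"
        by (rule nn_integral_scaleR_vec[OF _ c]) measurable
      also have "\<dots> = (\<integral>\<^sup>+x. ennreal (c ^ CARD('n)) * ennreal (F (c *\<^sub>R x) v) \<partial>lborel)"
        by (rule nn_integral_cmult[symmetric]) measurable
      also have "\<dots> = (\<integral>\<^sup>+x. ennreal (G x v) \<partial>lborel)"
      proof (rule nn_integral_cong)
        fix x :: "real^'n"
        have "c ^ CARD('n) * F (c *\<^sub>R x) v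
           = (c ^ CARD('n) * c powr d) * (\<psi> (lp_sum p x / v) * h x * (lp_sum p x / v) powr D * (v powr (D - 1) * \<phi> (lp_sum p x)))"
          using True c by (simp add: F_def lf hom)
        also have "\<dots> = G x v"
        proof -
          have "v powr (- D) * (lp_sum p x / v) powr D * v powr (D - 1) = lp_sum p x powr D * v powr (- D - 1)"
            using True lp_sum_nonneg[of p x] by (simp add: powr_divide powr_diff powr_minus field_simps)
          from arg_cong[OF this, of "\<lambda>z. \<psi> (lp_sum p x / v) * h x * \<phi> (lp_sum p x) * z"]
          have "v powr (- D) * (\<psi> (lp_sum p x / v) * h x * (lp_sum p x / v) powr D * (v powr (D - 1) * \<phi> (lp_sum p x)))
             = \<phi> (lp_sum p x) * h x * lp_sum p x powr D * (v powr (- D - 1) * \<psi> (lp_sum p x / v))"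
            by (simp only: mult_ac)
          then show ?thesis unfolding cnd G_def using True by simp
        qed
        finally show "ennreal (c ^ CARD('n)) * ennreal (F (c *\<^sub>R x) v) = ennreal (G x v)"
          using c by (subst ennreal_mult'[symmetric]) auto
      qed
      finally show ?thesis .
    qed (simp add: F_def G_def)
  qed
  also have "\<dots> = (\<integral>\<^sup>+x. \<integral>\<^sup>+v. ennreal (G x v) \<partial>lborel \<partial>lborel)"
    by (rule nn_integral_lborel_swap[symmetric]) (use Gm in measurable)
  also have "\<dots> = (\<integral>\<^sup>+x. ennreal (\<phi> (lp_sum p x) * h x) * (\<integral>\<^sup>+s. ennreal (indicator {0<..} s * (\<psi> s * s powr (D - 1))) \<partial>lborel) \<partial>lborel)"
  proof (rule nn_integral_cong_AE, use AE0 in eventually_elim)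
    fix x :: "real^'n" assume "x \<noteq> 0"
    then have f: "0 < lp_sum p x" by (rule lp_sum_pos)
    have "(\<integral>\<^sup>+s. ennreal (indicator {0<..} s * (\<psi> s * s powr (D - 1))) \<partial>lborel)
      = (\<integral>\<^sup>+s. ennreal (indicator {0<..} s * (lp_sum p x / s\<^sup>2 * (\<psi> (lp_sum p x / s) * (lp_sum p x / s) powr (D - 1)))) \<partial>lborel)"
      by (rule nn_integral_invert_real[OF _ _ f]) (use \<psi>0 in auto)
    then have "ennreal (\<phi> (lp_sum p x) * h x) * (\<integral>\<^sup>+s. ennreal (indicator {0<..} s * (\<psi> s * s powr (D - 1))) \<partial>lborel)
      = (\<integral>\<^sup>+s. ennreal (\<phi> (lp_sum p x) * h x) * ennreal (indicator {0<..} s * (lp_sum p x / s\<^sup>2 * (\<psi> (lp_sum p x / s) * (lp_sum p x / s) powr (D - 1)))) \<partial>lborel)"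
      by (simp add: nn_integral_cmult)
    also have "\<dots> = (\<integral>\<^sup>+v. ennreal (G x v) \<partial>lborel)"
    proof (rule nn_integral_cong)
      fix v :: real
      have eq: "lp_sum p x / v\<^sup>2 * (lp_sum p x / v) powr (D - 1) = lp_sum p x powr D * v powr (- D - 1)" if "0 < v"
        using f that by (simp add: powr_divide powr_diff powr_minus power2_eq_square field_simps)
      have eq2: "\<phi> (lp_sum p x) * h x * (lp_sum p x / v\<^sup>2 * (\<psi> (lp_sum p x / v) * (lp_sum p x / v) powr (D - 1)))
          = \<phi> (lp_sum p x) * h x * lp_sum p x powr D * (v powr (- D - 1) * \<psi> (lp_sum p x / v))" if "0 < v"
        using arg_cong[OF eq[OF that], of "\<lambda>z. \<phi> (lp_sum p x) * h x * \<psi> (lp_sum p x / v) * z"]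
        by (simp only: mult_ac)
      show "ennreal (\<phi> (lp_sum p x) * h x) * ennreal (indicator {0<..} v * (lp_sum p x / v\<^sup>2 * (\<psi> (lp_sum p x / v) * (lp_sum p x / v) powr (D - 1)))) = ennreal (G x v)"
        using h0[of x] \<phi>0 by (subst ennreal_mult'[symmetric]) (auto simp: G_def indicator_def eq2 simp del: times_divide_eq_left times_divide_eq_right)
    qed
    finally show "(\<integral>\<^sup>+v. ennreal (G x v) \<partial>lborel)
      = ennreal (\<phi> (lp_sum p x) * h x) * (\<integral>\<^sup>+s. ennreal (indicator {0<..} s * (\<psi> s * s powr (D - 1))) \<partial>lborel)" by simp
  qed
  also have "\<dots> = (\<integral>\<^sup>+x. ennreal (\<phi> (lp_sum p x) * h x) \<partial>lborel) * (\<integral>\<^sup>+s. ennreal (indicator {0<..} s * (\<psi> s * s powr (D - 1))) \<partial>lborel)"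
    by (rule nn_integral_multc) measurable
  finally show ?thesis .
qed

text \<open>In polar terms the two space integrals share their angular part and differ in their
  radial Gamma integrals. The exchange lemma with \<open>exp (- s)\<close> and
  \<open>exp (- s) * s powr c\<close> expresses this; it removes the power of \<open>lp_sum\<close>,
  which would not factor over the coordinates.\<close>

lemma homogeneous_integral_Gamma:
  fixes h :: "real^'n::finite \<Rightarrow> real"
  assumes p: "1 < p" and [measurable]: "h \<in> borel_measurable borel" and h0: "\<And>x. 0 \<le> h x"
    and hom: "\<And>c x. 0 < c \<Longrightarrow> h (c *\<^sub>R x) = c powr d * h x"
  defines "D \<equiv> (real CARD('n) + d) / p"
  assumes D: "0 < D" and c: "0 \<le> c"
  shows "(\<integral>\<^sup>+x. ennreal (exp (- lp_sum p x) * lp_sum p x powr c * h x) \<partial>lborel) * ennreal (Gamma D)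
    = (\<integral>\<^sup>+x. ennreal (exp (- lp_sum p x) * h x) \<partial>lborel) * ennreal (Gamma (D + c))"
proof -
  have "(\<integral>\<^sup>+s. ennreal (indicator {0<..} s * (exp (- s) * s powr c * s powr (D - 1))) \<partial>lborel)
     = (\<integral>\<^sup>+s. ennreal (indicator {0<..} s * (exp (- s) * s powr (D + c - 1))) \<partial>lborel)"
    by (intro nn_integral_cong) (auto simp: indicator_def mult.assoc powr_add[symmetric] algebra_simps)
  then show ?thesis
    using homogeneous_integral_exchange[OF p, of h "\<lambda>s. exp (- s)" "\<lambda>s. exp (- s) * s powr c" d, OF _ _ _ h0 _ _ hom]
      nn_integral_exp_powr[of D] nn_integral_exp_powr[of "D + c"] D c
    by (simp add: D_def[symmetric])
qed

section \<open>The one-dimensional integrals\<close>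

lemma nn_integral_even:
  fixes f :: "real \<Rightarrow> real"
  assumes [measurable]: "f \<in> borel_measurable borel"
  shows "(\<integral>\<^sup>+x. ennreal (f \<bar>x\<bar>) \<partial>lborel) = 2 * (\<integral>\<^sup>+x. ennreal (indicator {0<..} x * f x) \<partial>lborel)"
proof -
  have "(\<integral>\<^sup>+x. ennreal (f \<bar>x\<bar>) \<partial>lborel)
     = (\<integral>\<^sup>+x. ennreal (indicator {0<..} x * f x) + ennreal (indicator {0<..} (- x) * f (- x)) \<partial>lborel)"
    using AE_lborel_singleton[of "0::real"]
    by (intro nn_integral_cong_AE) (auto elim!: eventually_mono simp: indicator_def abs_if)
  also have "\<dots> = (\<integral>\<^sup>+x. ennreal (indicator {0<..} x * f x) \<partial>lborel)
      + (\<integral>\<^sup>+x. ennreal (indicator {0<..} (- x) * f (- x)) \<partial>lborel)"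
    by (rule nn_integral_add) measurable
  also have "(\<integral>\<^sup>+x. ennreal (indicator {0<..} (- x) * f (- x)) \<partial>lborel) = (\<integral>\<^sup>+x. ennreal (indicator {0<..} x * f x) \<partial>lborel)"
    using nn_integral_real_affine[of "\<lambda>x. ennreal (indicator {0<..} x * f x)" "-1" 0] by simp
  finally show ?thesis by (simp add: mult_2)
qed

lemma nn_integral_powr_exp_powr:
  assumes p: "1 < p" and a: "- 1 < a"
  shows "(\<integral>\<^sup>+x. ennreal (indicator {0<..} x * (p * (x powr a * exp (- (x powr p))))) \<partial>lborel) = ennreal (Gamma ((a + 1) / p))"
proof -
  define b where "b = (a + 1) / p"
  have b: "0 < b" using p a by (simp add: b_def)
  have im: "(\<lambda>x. x powr p) ` {0<..} = {0<..}"
  proof (intro equalityI subsetI)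
    fix y :: real assume "y \<in> {0<..}"
    then show "y \<in> (\<lambda>x. x powr p) ` {0<..}"
      using p by (intro image_eqI[of _ _ "y powr (1 / p)"]) (auto simp: powr_powr)
  qed auto
  have "(\<integral>\<^sup>+s. ennreal (indicator ((\<lambda>x. x powr p) ` {0<..}) s * (exp (- s) * s powr (b - 1))) \<partial>lborel)
     = (\<integral>\<^sup>+x. ennreal (indicator {0<..} x * (\<bar>p * x powr (p - 1)\<bar> * (exp (- (x powr p)) * (x powr p) powr (b - 1)))) \<partial>lborel)"
  proof (rule nn_integral_subst_real)
    show "inj_on (\<lambda>x. x powr p) {0<..}"
      using p by (intro inj_on_inverseI[of _ "\<lambda>y. y powr (1 / p)"]) (auto simp: powr_powr)
    show "((\<lambda>x. x powr p) has_real_derivative p * x powr (p - 1)) (at x within {0<..})" if "x \<in> {0<..}" for x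
      using that by (auto intro!: derivative_eq_intros)
  qed (auto simp: im)
  also have "\<dots> = (\<integral>\<^sup>+x. ennreal (indicator {0<..} x * (p * (x powr a * exp (- (x powr p))))) \<partial>lborel)"
  proof (rule nn_integral_cong)
    fix x :: real
    have "x powr (p - 1) * (x powr p) powr (b - 1) = x powr a"
    proof -
      have "p - 1 + p * (b - 1) = a" using p by (simp add: b_def field_simps)
      then show ?thesis by (simp only: powr_powr powr_add[symmetric])
    qed
    then have "p * x powr (p - 1) * (exp (- (x powr p)) * (x powr p) powr (b - 1)) = p * (x powr a * exp (- (x powr p)))"
      by (metis (no_types, opaque_lifting) mult.assoc mult.left_commute mult.commute)
    then show "ennreal (indicator {0<..} x * (\<bar>p * x powr (p - 1)\<bar> * (exp (- (x powr p)) * (x powr p) powr (b - 1)))) =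
        ennreal (indicator {0<..} x * (p * (x powr a * exp (- (x powr p)))))"
      using p by simp
  qed
  finally show ?thesis using nn_integral_exp_powr[OF b] by (simp add: im b_def)
qed

section \<open>The functions \<open>I_fun\<close>, \<open>J_fun\<close> and
  \<open>K_fun\<close>\<close>

lemma lp_weight_measurable [measurable (raw)]:
  assumes [measurable]: "f \<in> borel_measurable M" "g \<in> borel_measurable M"
  shows "(\<lambda>x. lp_weight p (f x) (g x)) \<in> borel_measurable M"
  unfolding lp_weight_def by measurable

lemma lp_weight_pos: "0 < lp_weight p \<theta> x"
  by (simp add: lp_weight_def)

text \<open>The weight at \<open>\<theta> = 0\<close> dominates. The exponents that occur are
  \<open>0\<close>, \<open>p - 2\<close> and \<open>2 * p - 2\<close>; for \<open>p > 1\<close> all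
  exceed \<open>- 1\<close>, the threshold for integrability at the origin.\<close>

lemma integrable_powr_lp_weight:
  assumes p: "1 < p" and a: "- 1 < a" and \<theta>: "0 \<le> \<theta>"
  shows "integrable lborel (\<lambda>x. \<bar>x\<bar> powr a * lp_weight p \<theta> x)"
proof (rule integrableI_bounded)
  have "(\<integral>\<^sup>+x. ennreal (norm (\<bar>x\<bar> powr a * lp_weight p \<theta> x)) \<partial>lborel)
     \<le> (\<integral>\<^sup>+x. ennreal (p * (\<bar>x\<bar> powr a * exp (- (\<bar>x\<bar> powr p)))) \<partial>lborel)"
  proof (intro nn_integral_mono ennreal_leI)
    fix x :: real
    have "norm (\<bar>x\<bar> powr a * lp_weight p \<theta> x) \<le> \<bar>x\<bar> powr a * exp (- (\<bar>x\<bar> powr p))"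
      using \<theta> by (auto simp: lp_weight_def intro!: mult_left_mono)
    \<comment> \<open>The factor \<open>p > 1\<close> is inserted to match the integrand of
      \<open>nn_integral_powr_exp_powr\<close>.\<close>
    also have "\<dots> \<le> p * (\<bar>x\<bar> powr a * exp (- (\<bar>x\<bar> powr p)))"
      using p by (intro mult_le_cancel_right1[THEN iffD2]) (auto simp: not_less)
    finally show "norm (\<bar>x\<bar> powr a * lp_weight p \<theta> x) \<le> p * (\<bar>x\<bar> powr a * exp (- (\<bar>x\<bar> powr p)))" .
  qed
  also have "\<dots> = 2 * ennreal (Gamma ((a + 1) / p))"
    using nn_integral_even[of "\<lambda>x. p * (x powr a * exp (- (x powr p)))"] nn_integral_powr_exp_powr[OF p a] by simp
  also have "\<dots> < \<infinity>" by (simp add: ennreal_mult_less_top)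
  finally show "(\<integral>\<^sup>+x. ennreal (norm (\<bar>x\<bar> powr a * lp_weight p \<theta> x)) \<partial>lborel) < \<infinity>" .
qed measurable

lemma integrable_lp_weight:
  assumes "1 < p" "0 \<le> \<theta>"
  shows "integrable lborel (lp_weight p \<theta>)"
proof -
  have "integrable lborel (\<lambda>x. \<bar>x\<bar> powr 0 * lp_weight p \<theta> x)"
    by (rule integrable_powr_lp_weight) (use assms in auto)
  \<comment> \<open>Since \<open>0 powr 0 = 0\<close>, the extra factor differs from
    \<open>1\<close> at the origin.\<close>
  moreover have "AE x in lborel. lp_weight p \<theta> x = \<bar>x\<bar> powr 0 * lp_weight p \<theta> x"
    using AE_lborel_singleton[of "0::real"] by eventually_elim simp
  ultimately show ?thesis
    by (subst integrable_cong_AE[where g = "\<lambda>x. \<bar>x\<bar> powr 0 * lp_weight p \<theta> x"]) measurable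
qed

text \<open>Dominated convergence for difference quotients along sequences in \<open>{0..}\<close>,
  so that \<open>\<theta> = 0\<close> gets a one-sided derivative. The mean value bound uses that
  the weight is largest at parameter \<open>0\<close>.\<close>

lemma I_fun_has_derivative:
  assumes p: "1 < p" and \<theta>: "0 \<le> \<theta>"
  shows "(I_fun p has_real_derivative - K_fun p \<theta>) (at \<theta> within {0..})"
  unfolding has_field_derivative_iff tendsto_at_iff_sequentially
proof (intro allI impI)
  fix X :: "nat \<Rightarrow> real" assume X: "\<forall>i. X i \<in> {0..} - {\<theta>}" and lim: "X \<longlonglongrightarrow> \<theta>"
  let ?q = "\<lambda>i x. (lp_weight p (X i) x - lp_weight p \<theta> x) / (X i - \<theta>)"
  have X0: "0 \<le> X i" "X i \<noteq> \<theta>" for i using X by auto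
  have der: "((\<lambda>t. lp_weight p t x) has_real_derivative - (\<bar>x\<bar> powr (2 * p - 2) * lp_weight p t x)) (at t within S)" for t x S
    unfolding lp_weight_def by (auto intro!: derivative_eq_intros)
  have bnd: "\<bar>?q i x\<bar> \<le> \<bar>x\<bar> powr (2 * p - 2) * lp_weight p 0 x" for i x
  proof -
    have "norm (lp_weight p (X i) x - lp_weight p \<theta> x) \<le> (\<bar>x\<bar> powr (2 * p - 2) * lp_weight p 0 x) * norm (X i - \<theta>)"
    proof (rule field_differentiable_bound[of "{0..}"])
      show "((\<lambda>t. lp_weight p t x) has_real_derivative - (\<bar>x\<bar> powr (2 * p - 2) * lp_weight p t x)) (at t within {0..})" for t
        by (rule der)
      show "norm (- (\<bar>x\<bar> powr (2 * p - 2) * lp_weight p t x)) \<le> \<bar>x\<bar> powr (2 * p - 2) * lp_weight p 0 x" if "t \<in> {0..}" for t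
        using that by (auto simp: lp_weight_def abs_mult intro!: mult_left_mono)
    qed (use X0 \<theta> in auto)
    then show ?thesis using X0(2)[of i] by (simp add: field_simps)
  qed
  have "(\<lambda>i. LBINT x. ?q i x) \<longlonglongrightarrow> (LBINT x. - (\<bar>x\<bar> powr (2 * p - 2) * lp_weight p \<theta> x))"
  proof (rule integral_dominated_convergence)
    show "integrable lborel (\<lambda>x. \<bar>x\<bar> powr (2 * p - 2) * lp_weight p 0 x)"
      by (rule integrable_powr_lp_weight) (use p in auto)
    show "AE x in lborel. (\<lambda>i. ?q i x) \<longlonglongrightarrow> - (\<bar>x\<bar> powr (2 * p - 2) * lp_weight p \<theta> x)"
    proof (rule AE_I2)
      fix x :: real
      show "(\<lambda>i. ?q i x) \<longlonglongrightarrow> - (\<bar>x\<bar> powr (2 * p - 2) * lp_weight p \<theta> x)"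
        using der[where t = \<theta> and x = x and S = "{0..}"] X lim
        unfolding has_field_derivative_iff tendsto_at_iff_sequentially by (auto simp: o_def)
    qed
  qed (use bnd in auto)
  moreover have "(LBINT x. ?q i x) = (I_fun p (X i) - I_fun p \<theta>) / (X i - \<theta>)" for i
    unfolding I_fun_def using integrable_lp_weight[OF p] X0[of i] \<theta> by simp
  moreover have "(LBINT x. - (\<bar>x\<bar> powr (2 * p - 2) * lp_weight p \<theta> x)) = - K_fun p \<theta>"
    unfolding K_fun_def by simp
  ultimately show "((\<lambda>y. (I_fun p y - I_fun p \<theta>) / (y - \<theta>)) \<circ> X) \<longlonglongrightarrow> - K_fun p \<theta>"
    by (simp only: o_def)
qed

lemma I_fun_measurable [measurable]: "I_fun p \<in> borel_measurable borel"
  unfolding I_fun_def[abs_def] by measurable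

lemma J_fun_measurable [measurable]: "J_fun p \<in> borel_measurable borel"
  unfolding J_fun_def[abs_def] by measurable

lemma K_fun_measurable [measurable]: "K_fun p \<in> borel_measurable borel"
  unfolding K_fun_def[abs_def] by measurable

lemma IJK_nonneg: "0 \<le> I_fun p \<theta>" "0 \<le> J_fun p \<theta>" "0 \<le> K_fun p \<theta>"
  unfolding I_fun_def J_fun_def K_fun_def
  using lp_weight_pos[of p \<theta>] by (auto intro!: integral_nonneg_AE simp: less_imp_le)

lemma nn_integral_IJK:
  assumes "1 < p" "0 \<le> \<theta>"
  shows "(\<integral>\<^sup>+x. ennreal (lp_weight p \<theta> x) \<partial>lborel) = ennreal (I_fun p \<theta>)"
    "(\<integral>\<^sup>+x. ennreal (\<bar>x\<bar> powr (p - 2) * lp_weight p \<theta> x) \<partial>lborel) = ennreal (J_fun p \<theta>)"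
    "(\<integral>\<^sup>+x. ennreal (\<bar>x\<bar> powr (2 * p - 2) * lp_weight p \<theta> x) \<partial>lborel) = ennreal (K_fun p \<theta>)"
  unfolding I_fun_def J_fun_def K_fun_def
  using assms lp_weight_pos[of p \<theta>]
  by (auto intro!: nn_integral_eq_integral integrable_lp_weight integrable_powr_lp_weight simp: less_imp_le)

section \<open>Expansion in the parallel distance\<close>

text \<open>\<open>i\<close> marks a summand of \<open>speed\<close>, and \<open>T\<close> the
  Jacobian factors that contribute their \<open>\<tau>\<close>-term. The power of the gradient norm
  arises from integrating \<open>\<tau> ^ card T\<close> up to a cutoff proportional to
  \<open>1 / norm (lp_grad p x)\<close>.\<close>

definition lp_kernel :: "real \<Rightarrow> 'n::finite \<Rightarrow> 'n set \<Rightarrow> real ^ 'n \<Rightarrow> real" where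
  "lp_kernel p i T x = \<bar>x $ i\<bar> powr (2 * p - 2) * (\<Prod>k\<in>T. \<bar>x $ k\<bar> powr (p - 2)) / norm (lp_grad p x) ^ Suc (card T)"

lemma lp_kernel_measurable [measurable]: "lp_kernel p i T \<in> borel_measurable borel"
  unfolding lp_kernel_def[abs_def] by measurable

lemma lp_kernel_nonneg: "0 \<le> lp_kernel p i T x"
  by (simp add: lp_kernel_def prod_nonneg)

text \<open>For \<open>m = Suc (card T)\<close> the degree \<open>p - m\<close> makes the argument
  \<open>(n + p - m) / p = 1 + (n - m) / p\<close> in \<open>homogeneous_integral_Gamma\<close>, the
  source of \<open>Gamma (1 + j / p)\<close> with \<open>j = n - m\<close>.\<close>

lemma lp_kernel_scaleR:
  fixes x :: "real^'n::finite"
  assumes c: "0 < c"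
  shows "lp_kernel p i T (c *\<^sub>R x) = c powr (p - real (Suc (card T))) * lp_kernel p i T x"
proof -
  let ?q = "card T"
  have "(\<Prod>k\<in>T. \<bar>(c *\<^sub>R x) $ k\<bar> powr (p - 2)) = c powr (?q * (p - 2)) * (\<Prod>k\<in>T. \<bar>x $ k\<bar> powr (p - 2))"
    using c by (simp add: abs_mult powr_mult prod.distrib powr_power)
  moreover have "\<bar>(c *\<^sub>R x) $ i\<bar> powr (2 * p - 2) = c powr (2 * p - 2) * \<bar>x $ i\<bar> powr (2 * p - 2)"
    using c by (simp add: abs_mult powr_mult)
  moreover have "norm (lp_grad p (c *\<^sub>R x)) ^ Suc ?q = c powr (Suc ?q * (p - 1)) * norm (lp_grad p x) ^ Suc ?q"
    unfolding lp_grad_scaleR[OF c] using c by (simp add: power_mult_distrib powr_power del: power_Suc of_nat_Suc)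
  ultimately have "lp_kernel p i T (c *\<^sub>R x) =
      (c powr (2 * p - 2) * c powr (?q * (p - 2)) / c powr (Suc ?q * (p - 1))) * lp_kernel p i T x"
    unfolding lp_kernel_def by simp
  also have "c powr (2 * p - 2) * c powr (?q * (p - 2)) / c powr (Suc ?q * (p - 1))
     = c powr (2 * p - 2 + ?q * (p - 2) - Suc ?q * (p - 1))"
    by (simp only: powr_add powr_diff)
  also have "2 * p - 2 + ?q * (p - 2) - Suc ?q * (p - 1) = p - real (Suc ?q)"
    by (simp add: algebra_simps)
  finally show ?thesis .
qed

text \<open>Each denominator in \<open>speed\<close> cancels one factor of the Jacobian, so a
  polynomial in \<open>\<tau>\<close> remains. Expanding the other factors, \<open>T\<close>
  collects the coordinates whose nonconstant term is chosen.\<close>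

lemma prod_flow_deriv_speed:
  fixes x :: "real^'n::finite"
  assumes p: "1 < p" and t: "0 \<le> \<tau>"
  shows "(\<Prod>i\<in>UNIV. flow_deriv p \<tau> (x $ i)) * speed p \<tau> x
    = (\<Sum>i\<in>UNIV. \<Sum>T\<in>Pow (UNIV - {i}). p * \<bar>x $ i\<bar> powr (2 * p - 2) *
        ((p - 1) ^ card T * \<tau> ^ card T * (\<Prod>k\<in>T. \<bar>x $ k\<bar> powr (p - 2))))"
  unfolding speed_def sum_distrib_left
proof (rule sum.cong[OF refl])
  fix i :: 'n
  let ?d = "\<lambda>k. flow_deriv p \<tau> (x $ k)"
  have "(\<Prod>k\<in>UNIV. ?d k) * (p * \<bar>x $ i\<bar> powr (2 * p - 2) / ?d i) = p * \<bar>x $ i\<bar> powr (2 * p - 2) * (\<Prod>k\<in>UNIV - {i}. ?d k)"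
    using flow_deriv_pos[OF p t, of "x $ i"] by (simp add: prod.remove[of UNIV i])
  also have "(\<Prod>k\<in>UNIV - {i}. ?d k) = (\<Prod>k\<in>UNIV - {i}. \<tau> * ((p - 1) * \<bar>x $ k\<bar> powr (p - 2)) + 1)"
    by (simp add: flow_deriv_def add.commute)
  also have "\<dots> = (\<Sum>T\<in>Pow (UNIV - {i}). (\<Prod>k\<in>T. \<tau> * ((p - 1) * \<bar>x $ k\<bar> powr (p - 2))) * (\<Prod>k\<in>UNIV - {i} - T. 1))"
    by (rule prod_add) simp
  also have "\<dots> = (\<Sum>T\<in>Pow (UNIV - {i}). (p - 1) ^ card T * \<tau> ^ card T * (\<Prod>k\<in>T. \<bar>x $ k\<bar> powr (p - 2)))"
    by (rule sum.cong) (simp_all add: prod.distrib mult_ac)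
  finally show "(\<Prod>k\<in>UNIV. ?d k) * (p * \<bar>x $ i\<bar> powr (2 * p - 2) / ?d i) =
      (\<Sum>T\<in>Pow (UNIV - {i}). p * \<bar>x $ i\<bar> powr (2 * p - 2) *
        ((p - 1) ^ card T * \<tau> ^ card T * (\<Prod>k\<in>T. \<bar>x $ k\<bar> powr (p - 2))))"
    by (simp add: sum_distrib_left)
qed

lemma nn_integral_power_cutoff:
  assumes g: "0 < g" and a: "0 \<le> a"
  shows "(\<integral>\<^sup>+\<tau>. ennreal (indicator {0<..} \<tau> * (\<tau> ^ q * (if \<tau> * g \<le> a then 1 else 0))) \<partial>lborel) = ennreal ((a / g) ^ Suc q / Suc q)"
proof -
  have "(\<integral>\<^sup>+\<tau>. ennreal (indicator {0<..} \<tau> * (\<tau> ^ q * (if \<tau> * g \<le> a then 1 else 0))) \<partial>lborel)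
    = (\<integral>\<^sup>+\<tau>. ennreal (\<tau> ^ q) * indicator {0..a / g} \<tau> \<partial>lborel)"
  proof (rule nn_integral_cong_AE, use AE_lborel_singleton[of "0::real"] in eventually_elim)
    fix \<tau> :: real assume "\<tau> \<noteq> 0"
    then show "ennreal (indicator {0<..} \<tau> * (\<tau> ^ q * (if \<tau> * g \<le> a then 1 else 0))) = ennreal (\<tau> ^ q) * indicator {0..a / g} \<tau>"
      using g by (auto simp: indicator_def field_simps)
  qed
  also have "\<dots> = ennreal ((a / g) ^ Suc q / Suc q - 0 ^ Suc q / Suc q)"
  proof (rule nn_integral_FTC_Icc)
    show "((\<lambda>t. t ^ Suc q / Suc q) has_real_derivative \<tau> ^ q) (at \<tau>)" for \<tau> :: real
      by (auto intro!: derivative_eq_intros simp del: power_Suc)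
  qed (use a g in auto)
  finally show ?thesis by simp
qed

text \<open>The polynomial in \<open>\<tau>\<close> is integrated term by term up to the cutoff
  \<open>a / g\<close>. As \<open>a\<close> is proportional to \<open>t\<close>, a term of degree
  \<open>card T\<close> contributes to \<open>t ^ Suc (card T)\<close>; this shift is why
  \<open>m = Suc (card T)\<close> later.\<close>

lemma nn_integral_parallel_density:
  fixes x :: "real^'n::finite"
  assumes p: "1 < p" and t: "0 \<le> t" and x: "x \<noteq> 0"
  shows "(\<integral>\<^sup>+\<tau>. ennreal ((\<Prod>i\<in>UNIV. flow_deriv p \<tau> (x $ i)) * parallel_density p t x \<tau>) \<partial>lborel)
    = (\<Sum>i\<in>UNIV. \<Sum>T\<in>Pow (UNIV - {i}). ennreal (p * (p - 1) ^ card T * t ^ Suc (card T) / Suc (card T)) *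
        ennreal (exp (- lp_sum p x) * lp_sum p x powr (real (Suc (card T)) / p) * lp_kernel p i T x))"
proof -
  define g where "g = norm (lp_grad p x)"
  define a where "a = t * lp_sum p x powr (1 / p)"
  have g: "0 < g" and a: "0 \<le> a" using x t by (auto simp: g_def a_def lp_grad_eq_0_iff)
  define C where "C i T = exp (- lp_sum p x) * (p * \<bar>x $ i\<bar> powr (2 * p - 2) * ((p - 1) ^ card T * (\<Prod>k\<in>T. \<bar>x $ k\<bar> powr (p - 2))))" for i T
  have C: "0 \<le> C i T" for i T using p by (auto simp: C_def intro!: mult_nonneg_nonneg prod_nonneg)
  let ?e = "\<lambda>q \<tau>. indicator {0<..} \<tau> * (\<tau> ^ q * (if \<tau> * g \<le> a then 1 else 0)) :: real"
  have e0: "0 \<le> ?e q \<tau>" for q \<tau> by (auto simp: indicator_def)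
  have "ennreal ((\<Prod>i\<in>UNIV. flow_deriv p \<tau> (x $ i)) * parallel_density p t x \<tau>)
     = (\<Sum>i\<in>UNIV. \<Sum>T\<in>Pow (UNIV - {i}). ennreal (C i T) * ennreal (?e (card T) \<tau>))" for \<tau>
  proof (cases "0 < \<tau>")
    case True
    have "(\<Prod>i\<in>UNIV. flow_deriv p \<tau> (x $ i)) * parallel_density p t x \<tau>
       = ((\<Prod>i\<in>UNIV. flow_deriv p \<tau> (x $ i)) * speed p \<tau> x) * (exp (- lp_sum p x) * (if \<tau> * g \<le> a then 1 else 0))"
      using True by (simp add: parallel_density_def g_def a_def)
    also have "\<dots> = (\<Sum>i\<in>UNIV. \<Sum>T\<in>Pow (UNIV - {i}). C i T * ?e (card T) \<tau>)"
      unfolding prod_flow_deriv_speed[OF p less_imp_le[OF True]] sum_distrib_right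
      using True by (intro sum.cong refl) (simp add: C_def mult_ac)
    finally show ?thesis
      using C e0 by (simp add: sum_nonneg ennreal_mult'' ennreal_mult sum_ennreal[symmetric] del: sum_ennreal)
  qed (simp add: parallel_density_def)
  then have "(\<integral>\<^sup>+\<tau>. ennreal ((\<Prod>i\<in>UNIV. flow_deriv p \<tau> (x $ i)) * parallel_density p t x \<tau>) \<partial>lborel)
    = (\<Sum>i\<in>UNIV. \<Sum>T\<in>Pow (UNIV - {i}). ennreal (C i T) * (\<integral>\<^sup>+\<tau>. ennreal (?e (card T) \<tau>) \<partial>lborel))"
    by (simp add: nn_integral_sum nn_integral_cmult)
  also have "\<dots> = (\<Sum>i\<in>UNIV. \<Sum>T\<in>Pow (UNIV - {i}). ennreal (p * (p - 1) ^ card T * t ^ Suc (card T) / Suc (card T)) *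
        ennreal (exp (- lp_sum p x) * lp_sum p x powr (real (Suc (card T)) / p) * lp_kernel p i T x))"
  proof (intro sum.cong refl)
    fix i and T :: "'n set"
    have "(lp_sum p x powr (1 / p)) ^ Suc (card T) = lp_sum p x powr (real (Suc (card T)) / p)"
      using lp_sum_pos[OF x, of p] by (simp add: powr_power del: power_Suc of_nat_Suc)
    then have "C i T * ((a / g) ^ Suc (card T) / Suc (card T)) =
       p * (p - 1) ^ card T * t ^ Suc (card T) / Suc (card T) *
        (exp (- lp_sum p x) * lp_sum p x powr (real (Suc (card T)) / p) * lp_kernel p i T x)"
      unfolding a_def power_divide power_mult_distrib C_def lp_kernel_def g_def[symmetric]
      by (simp del: power_Suc of_nat_Suc add: mult_ac)
    then show "ennreal (C i T) * (\<integral>\<^sup>+\<tau>. ennreal (?e (card T) \<tau>) \<partial>lborel) =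
      ennreal (p * (p - 1) ^ card T * t ^ Suc (card T) / Suc (card T)) *
        ennreal (exp (- lp_sum p x) * lp_sum p x powr (real (Suc (card T)) / p) * lp_kernel p i T x)"
      unfolding nn_integral_power_cutoff[OF g a]
      using C p t by (simp only: ennreal_mult'[symmetric] C) (subst ennreal_mult'[symmetric], simp_all)
  qed
  finally show ?thesis .
qed

section \<open>Separation of the coordinates by a Gamma integral\<close>

lemma nn_integral_exp_powr_scaled:
  assumes b: "0 < b" and c: "0 < c"
  shows "(\<integral>\<^sup>+\<theta>. ennreal (indicator {0<..} \<theta> * (exp (- (c * \<theta>)) * \<theta> powr (b - 1))) \<partial>lborel) = ennreal (Gamma b / c powr b)"
proof -
  have "(\<integral>\<^sup>+\<theta>. ennreal (indicator {0<..} \<theta> * (exp (- (c * \<theta>)) * \<theta> powr (b - 1))) \<partial>lborel)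
     = (\<integral>\<^sup>+\<theta>. ennreal (indicator {0<..} \<theta> * (1 / c * (exp (- (c * (1 / c * \<theta>))) * (1 / c * \<theta>) powr (b - 1)))) \<partial>lborel)"
    by (rule nn_integral_scale_real) (use c in auto)
  also have "\<dots> = (\<integral>\<^sup>+\<theta>. ennreal (1 / c powr b) * ennreal (indicator {0<..} \<theta> * (exp (- \<theta>) * \<theta> powr (b - 1))) \<partial>lborel)"
    using c by (intro nn_integral_cong, subst ennreal_mult'[symmetric])
       (auto simp: indicator_def powr_divide powr_diff)
  also have "\<dots> = ennreal (1 / c powr b) * ennreal (Gamma b)"
    by (simp add: nn_integral_cmult nn_integral_exp_powr[OF b])
  finally show ?thesis using c by (simp add: ennreal_mult'[symmetric])
qed

lemma sum_Pow_card:
  fixes a :: "nat \<Rightarrow> real"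
  assumes "finite A"
  shows "(\<Sum>T\<in>Pow A. a (card T)) = (\<Sum>q\<le>card A. real (card A choose q) * a q)"
proof -
  have "(\<Sum>q\<le>card A. \<Sum>T\<in>{T \<in> Pow A. card T = q}. a (card T)) = (\<Sum>T\<in>Pow A. a (card T))"
    using assms by (intro sum.group) (auto intro: card_mono)
  moreover have "(\<Sum>T\<in>{T \<in> Pow A. card T = q}. a (card T)) = real (card A choose q) * a q" for q
    using n_subsets[OF assms, of q] by (simp add: Pow_def)
  then have "(\<Sum>q\<le>card A. \<Sum>T\<in>{T \<in> Pow A. card T = q}. a (card T)) = (\<Sum>q\<le>card A. real (card A choose q) * a q)"
    by (intro sum.cong refl)
  ultimately show ?thesis by (rule trans[OF sym])
qed

text \<open>The integrand of the theorem, indexed by the power \<open>m = n - j\<close> of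
  \<open>t\<close> to which it belongs.\<close>

definition lp_integrand :: "real \<Rightarrow> nat \<Rightarrow> nat \<Rightarrow> real \<Rightarrow> real" where
  "lp_integrand p n m \<theta> = \<theta> powr (real m / 2 - 1) * I_fun p \<theta> ^ (n - m) * J_fun p \<theta> ^ (m - 1) * K_fun p \<theta>"

lemma lp_integrand_measurable [measurable]: "lp_integrand p n m \<in> borel_measurable borel"
  unfolding lp_integrand_def[abs_def] by measurable

lemma lp_integrand_nonneg: "0 \<le> lp_integrand p n m \<theta>"
  using IJK_nonneg[of p \<theta>] by (auto simp: lp_integrand_def intro!: mult_nonneg_nonneg)

text \<open>The integrand is a product over coordinates: coordinate \<open>i\<close> yields
  \<open>K_fun\<close>, those in \<open>T\<close> yield \<open>J_fun\<close>, and the rest yield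
  \<open>I_fun\<close>.\<close>

lemma nn_integral_prod_lp_weight:
  fixes i :: "'n::finite"
  assumes p: "1 < p" and \<theta>: "0 \<le> \<theta>" and i: "i \<notin> T"
  shows "(\<integral>\<^sup>+x. ennreal (\<bar>x $ i\<bar> powr (2 * p - 2) * (\<Prod>k\<in>T. \<bar>x $ k\<bar> powr (p - 2)) * (\<Prod>k\<in>UNIV. lp_weight p \<theta> (x $ k))) \<partial>(lborel :: (real^'n) measure))
    = ennreal (I_fun p \<theta> ^ (CARD('n) - Suc (card T)) * J_fun p \<theta> ^ card T * K_fun p \<theta>)"
proof -
  define f where "f k y = (if k = i then \<bar>y\<bar> powr (2 * p - 2) else if k \<in> T then \<bar>y\<bar> powr (p - 2) else 1) * lp_weight p \<theta> y" for k :: 'n and y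
  have split: "(\<Prod>k\<in>UNIV. if k = i then a k else if k \<in> T then b k else c k) = a i * (\<Prod>k\<in>T. b k) * (\<Prod>k\<in>- insert i T. c k)"
    for a b c :: "'n \<Rightarrow> real"
  proof -
    have "(\<Prod>k\<in>UNIV. if k = i then a k else if k \<in> T then b k else c k)
       = (\<Prod>k\<in>insert i T \<union> - insert i T. if k = i then a k else if k \<in> T then b k else c k)"
      by (rule prod.cong) auto
    also have "\<dots> = (\<Prod>k\<in>insert i T. if k = i then a k else if k \<in> T then b k else c k)
        * (\<Prod>k\<in>- insert i T. if k = i then a k else if k \<in> T then b k else c k)"
      by (rule prod.union_disjoint) auto
    also have "(\<Prod>k\<in>insert i T. if k = i then a k else if k \<in> T then b k else c k) = a i * (\<Prod>k\<in>T. b k)"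
      using i by (subst prod.insert) (auto intro!: prod.cong)
    also have "(\<Prod>k\<in>- insert i T. if k = i then a k else if k \<in> T then b k else c k) = (\<Prod>k\<in>- insert i T. c k)"
      by (rule prod.cong) auto
    finally show ?thesis .
  qed
  have card: "card (- insert i T) = CARD('n) - Suc (card T)"
    using i by (simp add: Compl_eq_Diff_UNIV card_Diff_subset)
  have f0: "0 \<le> f k y" for k y using lp_weight_pos[of p \<theta> y] by (auto simp: f_def less_imp_le)
  have fm [measurable]: "f k \<in> borel_measurable borel" for k
    unfolding f_def[abs_def] by measurable
  have "(\<integral>\<^sup>+x. ennreal (\<bar>x $ i\<bar> powr (2 * p - 2) * (\<Prod>k\<in>T. \<bar>x $ k\<bar> powr (p - 2)) * (\<Prod>k\<in>UNIV. lp_weight p \<theta> (x $ k))) \<partial>(lborel :: (real^'n) measure))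
     = (\<integral>\<^sup>+x. (\<Prod>k\<in>UNIV. ennreal (f k (x $ k))) \<partial>(lborel :: (real^'n) measure))"
  proof (rule nn_integral_cong)
    fix x :: "real^'n"
    have "(\<Prod>k\<in>UNIV. f k (x $ k)) = \<bar>x $ i\<bar> powr (2 * p - 2) * (\<Prod>k\<in>T. \<bar>x $ k\<bar> powr (p - 2)) * (\<Prod>k\<in>UNIV. lp_weight p \<theta> (x $ k))"
      unfolding f_def prod.distrib by (subst split) simp
    then show "ennreal (\<bar>x $ i\<bar> powr (2 * p - 2) * (\<Prod>k\<in>T. \<bar>x $ k\<bar> powr (p - 2)) * (\<Prod>k\<in>UNIV. lp_weight p \<theta> (x $ k)))
      = (\<Prod>k\<in>UNIV. ennreal (f k (x $ k)))"
      using f0 by (simp add: prod_ennreal)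
  qed
  also have "\<dots> = (\<Prod>k\<in>UNIV. \<integral>\<^sup>+y. ennreal (f k y) \<partial>lborel)"
    by (rule nn_integral_lborel_vec_prod) measurable
  also have "\<dots> = (\<Prod>k\<in>UNIV. ennreal (if k = i then K_fun p \<theta> else if k \<in> T then J_fun p \<theta> else I_fun p \<theta>))"
    using nn_integral_IJK[OF p \<theta>] by (intro prod.cong refl) (auto simp: f_def)
  also have "\<dots> = ennreal (K_fun p \<theta> * (\<Prod>k\<in>T. J_fun p \<theta>) * (\<Prod>k\<in>- insert i T. I_fun p \<theta>))"
    using IJK_nonneg[of p \<theta>] by (subst prod_ennreal) (auto simp: split[of "\<lambda>_. K_fun p \<theta>" "\<lambda>_. J_fun p \<theta>" "\<lambda>_. I_fun p \<theta>"])
  also have "K_fun p \<theta> * (\<Prod>k\<in>T. J_fun p \<theta>) * (\<Prod>k\<in>- insert i T. I_fun p \<theta>)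
     = I_fun p \<theta> ^ (CARD('n) - Suc (card T)) * J_fun p \<theta> ^ card T * K_fun p \<theta>"
    by (simp add: card)
  finally show ?thesis .
qed

text \<open>With \<open>G = lp_grad p x\<close>, the factor \<open>Gamma (m / 2) / |G|^m\<close> is
  the integral of \<open>\<theta>^(m/2-1) exp (- \<theta> |G|^2)\<close>. As \<open>|G|^2\<close> is
  a sum over coordinates, \<open>exp (- lp_sum p x - \<theta> |G|^2)\<close> is a product of
  weights, and exchanging the integrals separates the coordinates.\<close>

lemma nn_integral_lp_kernel:
  fixes i :: "'n::finite"
  assumes p: "1 < p" and i: "i \<notin> T"
  defines "m \<equiv> Suc (card T)"
  shows "(\<integral>\<^sup>+x. ennreal (exp (- lp_sum p x) * lp_kernel p i T x) \<partial>(lborel :: (real^'n) measure)) * ennreal (Gamma (real m / 2))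
     = (\<integral>\<^sup>+\<theta>. ennreal (indicator {0<..} \<theta> * lp_integrand p CARD('n) m \<theta>) \<partial>lborel)"
proof -
  define A where "A x = \<bar>x $ i\<bar> powr (2 * p - 2) * (\<Prod>k\<in>T. \<bar>x $ k\<bar> powr (p - 2))" for x :: "real^'n"
  have A0: "0 \<le> A x" for x by (simp add: A_def prod_nonneg)
  have Am [measurable]: "A \<in> borel_measurable borel" unfolding A_def[abs_def] by measurable
  have m: "0 < real m / 2" by (simp add: m_def)
  define F where "F x \<theta> = indicator {0<..} \<theta> * (\<theta> powr (real m / 2 - 1) * (A x * (\<Prod>k\<in>UNIV. lp_weight p \<theta> (x $ k))))" for x :: "real^'n" and \<theta>
  have weights: "(\<Prod>k\<in>UNIV. lp_weight p \<theta> (x $ k)) = exp (- lp_sum p x) * exp (- (norm (lp_grad p x) ^ 2 * \<theta>))" for x :: "real^'n" and \<theta>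
    unfolding lp_weight_def norm_lp_grad_sq lp_sum_def
    by (simp add: exp_sum[symmetric] exp_add[symmetric] sum_subtractf sum_negf sum_distrib_left mult.commute)
  have "(\<integral>\<^sup>+x. ennreal (exp (- lp_sum p x) * lp_kernel p i T x) \<partial>(lborel :: (real^'n) measure)) * ennreal (Gamma (real m / 2))
     = (\<integral>\<^sup>+x. ennreal (exp (- lp_sum p x) * lp_kernel p i T x) * ennreal (Gamma (real m / 2)) \<partial>(lborel :: (real^'n) measure))"
    by (rule nn_integral_multc[symmetric]) measurable
  also have "\<dots> = (\<integral>\<^sup>+x. \<integral>\<^sup>+\<theta>. ennreal (F x \<theta>) \<partial>lborel \<partial>(lborel :: (real^'n) measure))"
  proof (rule nn_integral_cong_AE, use AE_lborel_singleton[of "0 :: real^'n"] in eventually_elim)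
    fix x :: "real^'n" assume "x \<noteq> 0"
    then have g: "0 < norm (lp_grad p x)" by (simp add: lp_grad_eq_0_iff)
    then have gp: "(norm (lp_grad p x))\<^sup>2 powr (real m / 2) = norm (lp_grad p x) ^ m"
    proof -
      have "(norm (lp_grad p x))\<^sup>2 powr (real m / 2) = (norm (lp_grad p x) powr 2) powr (real m / 2)"
        using g by simp
      also have "\<dots> = norm (lp_grad p x) powr real m" unfolding powr_powr by simp
      finally show ?thesis using g by (simp add: powr_realpow)
    qed
    have "(\<integral>\<^sup>+\<theta>. ennreal (F x \<theta>) \<partial>lborel)
       = (\<integral>\<^sup>+\<theta>. ennreal (exp (- lp_sum p x) * A x) * ennreal (indicator {0<..} \<theta> * (exp (- (norm (lp_grad p x) ^ 2 * \<theta>)) * \<theta> powr (real m / 2 - 1))) \<partial>lborel)"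
      using A0[of x] by (intro nn_integral_cong, subst ennreal_mult'[symmetric]) (auto simp: F_def weights mult_ac)
    also have "\<dots> = ennreal (exp (- lp_sum p x) * A x) * ennreal (Gamma (real m / 2) / norm (lp_grad p x) ^ m)"
      using nn_integral_exp_powr_scaled[OF m, of "norm (lp_grad p x) ^ 2"] g by (simp add: nn_integral_cmult gp)
    also have "\<dots> = ennreal (exp (- lp_sum p x) * lp_kernel p i T x) * ennreal (Gamma (real m / 2))"
      using A0[of x] lp_kernel_nonneg[of p i T x]
      by (subst (1 2) ennreal_mult'[symmetric]) (auto simp: lp_kernel_def A_def m_def mult_ac simp del: power_Suc)
    finally show "ennreal (exp (- lp_sum p x) * lp_kernel p i T x) * ennreal (Gamma (real m / 2)) = (\<integral>\<^sup>+\<theta>. ennreal (F x \<theta>) \<partial>lborel)" ..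
  qed
  also have "\<dots> = (\<integral>\<^sup>+\<theta>. \<integral>\<^sup>+x. ennreal (F x \<theta>) \<partial>(lborel :: (real^'n) measure) \<partial>lborel)"
    by (rule nn_integral_lborel_swap) (unfold F_def, measurable)
  also have "\<dots> = (\<integral>\<^sup>+\<theta>. ennreal (indicator {0<..} \<theta> * lp_integrand p CARD('n) m \<theta>) \<partial>lborel)"
  proof (rule nn_integral_cong)
    fix \<theta> :: real
    show "(\<integral>\<^sup>+x. ennreal (F x \<theta>) \<partial>(lborel :: (real^'n) measure)) = ennreal (indicator {0<..} \<theta> * lp_integrand p CARD('n) m \<theta>)"
    proof (cases "0 < \<theta>")
      case True
      have "(\<integral>\<^sup>+x. ennreal (F x \<theta>) \<partial>(lborel :: (real^'n) measure))
        = (\<integral>\<^sup>+x. ennreal (\<theta> powr (real m / 2 - 1)) * ennreal (A x * (\<Prod>k\<in>UNIV. lp_weight p \<theta> (x $ k))) \<partial>lborel)"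
        using True by (simp add: F_def ennreal_mult')
      also have "\<dots> = ennreal (\<theta> powr (real m / 2 - 1)) *
          ennreal (I_fun p \<theta> ^ (CARD('n) - Suc (card T)) * J_fun p \<theta> ^ card T * K_fun p \<theta>)"
        using nn_integral_prod_lp_weight[OF p less_imp_le[OF True] i]
        by (subst nn_integral_cmult) (simp_all add: A_def)
      also have "\<dots> = ennreal (indicator {0<..} \<theta> * lp_integrand p CARD('n) m \<theta>)"
        using True by (subst ennreal_mult'[symmetric]) (auto simp: lp_integrand_def m_def mult_ac)
      finally show ?thesis .
    qed (simp add: F_def)
  qed
  finally show ?thesis .
qed

text \<open>\<open>homogeneous_integral_Gamma\<close> with \<open>d = p - m\<close> and
  \<open>c = m / p\<close> removes the power of \<open>lp_sum\<close>;
  \<open>nn_integral_lp_kernel\<close> does the rest. The Gamma factors stay multiplied out because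
  finiteness of the integrals is established later.\<close>

lemma nn_integral_lp_kernel_weighted:
  fixes i :: "'n::finite"
  assumes p: "1 < p" and i: "i \<notin> T"
  defines "m \<equiv> Suc (card T)"
  shows "(\<integral>\<^sup>+x. ennreal (exp (- lp_sum p x) * lp_sum p x powr (real m / p) * lp_kernel p i T x) \<partial>(lborel :: (real^'n) measure))
       * ennreal (Gamma (1 + real (CARD('n) - m) / p) * Gamma (real m / 2))
     = ennreal (Gamma (1 + real CARD('n) / p)) * (\<integral>\<^sup>+\<theta>. ennreal (indicator {0<..} \<theta> * lp_integrand p CARD('n) m \<theta>) \<partial>lborel)"
proof -
  have "card (insert i T) \<le> CARD('n)" by (rule card_mono) auto
  then have mn: "m \<le> CARD('n)" using i by (simp add: m_def)
  let ?D = "(real CARD('n) + (p - real m)) / p"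
  have D: "?D = 1 + real (CARD('n) - m) / p" "?D + real m / p = 1 + real CARD('n) / p"
    using p mn by (auto simp: field_simps)
  have D0: "0 < ?D" unfolding D(1) using p by (simp add: add_pos_nonneg)
  have G: "(\<integral>\<^sup>+x. ennreal (exp (- lp_sum p x) * lp_sum p x powr (real m / p) * lp_kernel p i T x) \<partial>(lborel :: (real^'n) measure)) * ennreal (Gamma ?D)
     = (\<integral>\<^sup>+x. ennreal (exp (- lp_sum p x) * lp_kernel p i T x) \<partial>(lborel :: (real^'n) measure)) * ennreal (Gamma (?D + real m / p))"
    by (rule homogeneous_integral_Gamma[OF p]) (use D0 p lp_kernel_nonneg lp_kernel_scaleR in \<open>auto simp: m_def simp del: of_nat_Suc\<close>)
  have "ennreal (Gamma (1 + real (CARD('n) - m) / p) * Gamma (real m / 2)) = ennreal (Gamma ?D) * ennreal (Gamma (real m / 2))"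
    unfolding D(1)[symmetric] using D0 by (intro ennreal_mult' less_imp_le Gamma_real_pos)
  then have "(\<integral>\<^sup>+x. ennreal (exp (- lp_sum p x) * lp_sum p x powr (real m / p) * lp_kernel p i T x) \<partial>(lborel :: (real^'n) measure))
       * ennreal (Gamma (1 + real (CARD('n) - m) / p) * Gamma (real m / 2))
     = ((\<integral>\<^sup>+x. ennreal (exp (- lp_sum p x) * lp_kernel p i T x) \<partial>(lborel :: (real^'n) measure)) * ennreal (Gamma (real m / 2))) * ennreal (Gamma (?D + real m / p))"
    using G by (simp only: mult.assoc[symmetric]) (simp only: mult_ac)
  then show ?thesis
    unfolding m_def nn_integral_lp_kernel[OF p i] D(2)[unfolded m_def] by (simp add: mult.commute)
qed

section \<open>Intrinsic volumes\<close>

text \<open>Extended-valued, since finiteness is deduced afterwards from the finite volume of a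
  parallel body.\<close>

definition lp_moment :: "real \<Rightarrow> 'n::finite \<Rightarrow> 'n set \<Rightarrow> ennreal" where
  "lp_moment p i T = (\<integral>\<^sup>+x. ennreal (exp (- lp_sum p x) * lp_sum p x powr (real (Suc (card T)) / p) * lp_kernel p i T x) \<partial>lborel)"

lemma parallel_volume_moments:
  assumes p: "1 < p" and t: "0 \<le> t"
  shows "ennreal (Gamma (1 + real CARD('n::finite) / p) *
        (measure lebesgue (lp_parallel p t :: (real^'n) set) - measure lebesgue (lp_ball p :: (real^'n) set)))
    = (\<Sum>i\<in>UNIV. \<Sum>T\<in>Pow (UNIV - {i :: 'n}). ennreal (p * (p - 1) ^ card T * t ^ Suc (card T) / Suc (card T)) * lp_moment p i T)"
proof -
  have "ennreal (Gamma (1 + real CARD('n) / p) *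
        (measure lebesgue (lp_parallel p t :: (real^'n) set) - measure lebesgue (lp_ball p :: (real^'n) set)))
     = (\<integral>\<^sup>+x. \<integral>\<^sup>+\<tau>. ennreal ((\<Prod>i\<in>UNIV. flow_deriv p \<tau> (x $ i)) * parallel_density p t x \<tau>) \<partial>lborel \<partial>(lborel :: (real^'n) measure))"
    using parallel_volume_flow[OF p t, where 'n = 'n] parallel_volume_layers[OF p t, where 'n = 'n] by (rule trans[OF sym, rotated])
  also have "\<dots> = (\<integral>\<^sup>+x. (\<Sum>i\<in>UNIV. \<Sum>T\<in>Pow (UNIV - {i}). ennreal (p * (p - 1) ^ card T * t ^ Suc (card T) / Suc (card T)) *
        ennreal (exp (- lp_sum p x) * lp_sum p x powr (real (Suc (card T)) / p) * lp_kernel p i T x)) \<partial>(lborel :: (real^'n) measure))"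
    by (rule nn_integral_cong_AE, use AE_lborel_singleton[of "0 :: real^'n"] in eventually_elim)
       (rule nn_integral_parallel_density[OF p t])
  also have "\<dots> = (\<Sum>i\<in>UNIV. \<Sum>T\<in>Pow (UNIV - {i :: 'n}). ennreal (p * (p - 1) ^ card T * t ^ Suc (card T) / Suc (card T)) * lp_moment p i T)"
    unfolding lp_moment_def by (simp add: nn_integral_sum nn_integral_cmult del: of_nat_Suc power_Suc)
  finally show ?thesis .
qed

text \<open>At \<open>t = 1\<close> a positive multiple of this moment is one of the nonnegative
  summands in \<open>parallel_volume_moments\<close>, whose total is a real number.\<close>

lemma lp_moment_finite:
  assumes p: "1 < p" and i: "i \<notin> T"
  shows "lp_moment p (i :: 'n::finite) T < \<infinity>"
proof -
  let ?c = "\<lambda>T. ennreal (p * (p - 1) ^ card T * 1 ^ Suc (card T) / Suc (card T))"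
  have "?c T * lp_moment p i T \<le> (\<Sum>T\<in>Pow (UNIV - {i}). ?c T * lp_moment p i T)"
    using i by (intro member_le_sum) auto
  also have "\<dots> \<le> (\<Sum>i\<in>UNIV. \<Sum>T\<in>Pow (UNIV - {i :: 'n}). ?c T * lp_moment p i T)"
    by (rule member_le_sum) (auto simp del: power_one)
  also have "\<dots> < \<infinity>"
    unfolding parallel_volume_moments[OF p zero_le_one, symmetric] by simp
  finally have "?c T * lp_moment p i T < \<infinity>" .
  moreover have "?c T \<noteq> 0" using p by simp
  ultimately show ?thesis by (auto simp: ennreal_mult_less_top)
qed

text \<open>A set of \<open>m\<close> coordinates, split into one point \<open>i\<close> and the
  rest \<open>T\<close>, realizes this integral as a positive multiple of a finite moment.\<close>

lemma nn_integral_lp_integrand_finite: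
  assumes p: "1 < p" and m: "0 < m" "m \<le> CARD('n::finite)"
  shows "(\<integral>\<^sup>+\<theta>. ennreal (indicator {0<..} \<theta> * lp_integrand p CARD('n) m \<theta>) \<partial>lborel) < \<infinity>"
proof -
  obtain S :: "'n set" where S: "card S = m" "finite S"
    using m obtain_subset_with_card_n[of m "UNIV :: 'n set"] by auto
  then obtain i T where T: "S = insert i T" "i \<notin> T" "Suc (card T) = m"
    using m by (metis card_0_eq card_insert_disjoint finite_insert insertI1 less_numeral_extra(3) mk_disjoint_insert subsetI subset_empty)
  have "lp_moment p i T * ennreal (Gamma (1 + real (CARD('n) - m) / p) * Gamma (real m / 2)) < \<infinity>"
    using lp_moment_finite[OF p T(2)] by (simp add: ennreal_mult_less_top)
  then have "ennreal (Gamma (1 + real CARD('n) / p)) * (\<integral>\<^sup>+\<theta>. ennreal (indicator {0<..} \<theta> * lp_integrand p CARD('n) m \<theta>) \<partial>lborel) < \<infinity>"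
    unfolding lp_moment_def T(3) nn_integral_lp_kernel_weighted[OF p T(2), unfolded T(3)] .
  moreover have "0 < Gamma (1 + real CARD('n) / p)"
    using p by (intro Gamma_real_pos add_pos_nonneg) auto
  ultimately show ?thesis by (auto simp: ennreal_mult_less_top)
qed

lemma lp_integrand_integral:
  assumes p: "1 < p" and m: "0 < m" "m \<le> CARD('n::finite)"
  shows "set_integrable lborel {0..} (lp_integrand p CARD('n) m)"
    and "(\<integral>\<^sup>+\<theta>. ennreal (indicator {0<..} \<theta> * lp_integrand p CARD('n) m \<theta>) \<partial>lborel)
       = ennreal (LBINT \<theta>:{0..}. lp_integrand p CARD('n) m \<theta>)"
proof -
  let ?f = "\<lambda>\<theta>. indicator {0..} \<theta> * lp_integrand p CARD('n) m \<theta>"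
  have eq: "(\<integral>\<^sup>+\<theta>. ennreal (indicator {0<..} \<theta> * lp_integrand p CARD('n) m \<theta>) \<partial>lborel) = (\<integral>\<^sup>+\<theta>. ennreal (?f \<theta>) \<partial>lborel)"
    by (rule nn_integral_cong_AE, use AE_lborel_singleton[of "0::real"] in eventually_elim) (auto simp: indicator_def)
  have f0: "0 \<le> ?f \<theta>" for \<theta> using lp_integrand_nonneg[of p "CARD('n)" m \<theta>] by simp
  have int: "integrable lborel ?f"
    using nn_integral_lp_integrand_finite[OF p m] f0 unfolding eq
    by (intro integrableI_nonneg) auto
  then show "set_integrable lborel {0..} (lp_integrand p CARD('n) m)"
    by (simp add: set_integrable_def)
  show "(\<integral>\<^sup>+\<theta>. ennreal (indicator {0<..} \<theta> * lp_integrand p CARD('n) m \<theta>) \<partial>lborel)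
       = ennreal (LBINT \<theta>:{0..}. lp_integrand p CARD('n) m \<theta>)"
    unfolding eq set_lebesgue_integral_def using nn_integral_eq_integral[OF int] f0 by simp
qed

text \<open>The moments depend on \<open>T\<close> through its cardinality alone, so the double sum
  over \<open>i\<close> and \<open>T\<close> collapses to one over \<open>q = card T\<close> with
  multiplicity \<open>n * ((n - 1) choose q)\<close>. The common factor
  \<open>Gamma (1 + n / p)\<close> cancels.\<close>

lemma parallel_volume_polynomial:
  assumes p: "1 < p" and t: "0 \<le> t"
  shows "measure lebesgue (lp_parallel p t :: (real^'n::finite) set) = measure lebesgue (lp_ball p :: (real^'n) set) +
     (\<Sum>m=1..CARD('n). p * (p - 1) ^ (m - 1) * real (CARD('n) choose m) /
        (Gamma (1 + real (CARD('n) - m) / p) * Gamma (real m / 2)) * (LBINT \<theta>:{0..}. lp_integrand p CARD('n) m \<theta>) * t ^ m)"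
proof -
  let ?n = "CARD('n)"
  define N where "N m = (LBINT \<theta>:{0..}. lp_integrand p ?n m \<theta>)" for m
  define G where "G = Gamma (1 + real ?n / p)"
  define B where "B m = Gamma (1 + real (?n - m) / p) * Gamma (real m / 2)" for m
  have n0: "0 < ?n" by simp
  have G: "0 < G" unfolding G_def using p by (intro Gamma_real_pos add_pos_nonneg) auto
  have B: "0 < B m" if "0 < m" for m
    unfolding B_def using p that by (intro mult_pos_pos Gamma_real_pos add_pos_nonneg) auto
  have N0: "0 \<le> N m" for m
    unfolding N_def set_lebesgue_integral_def by (intro integral_nonneg_AE) (simp add: lp_integrand_nonneg)
  \<comment> \<open>Finiteness of the moment allows division by the Gamma factors in the
    reals.\<close>
  have mom: "lp_moment p i T = ennreal (G * N (Suc (card T)) / B (Suc (card T)))" if T: "T \<subseteq> UNIV - {i}" for i :: 'n and T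
  proof -
    have i: "i \<notin> T" using T by auto
    have "card (insert i T) \<le> ?n" by (rule card_mono) auto
    then have m: "Suc (card T) \<le> ?n" using i by simp
    obtain x where x: "lp_moment p i T = ennreal x" "0 \<le> x"
      using lp_moment_finite[OF p i] by (cases "lp_moment p i T" rule: ennreal_cases) auto
    have "lp_moment p i T * ennreal (B (Suc (card T))) = ennreal G * ennreal (N (Suc (card T)))"
      using nn_integral_lp_kernel_weighted[OF p i] lp_integrand_integral(2)[OF p _ m]
      by (simp add: lp_moment_def B_def G_def N_def del: of_nat_Suc)
    then have "ennreal (x * B (Suc (card T))) = ennreal (G * N (Suc (card T)))"
      using x G B[of "Suc (card T)"] by (simp add: ennreal_mult'[symmetric] ennreal_mult''[symmetric])
    then have "x * B (Suc (card T)) = G * N (Suc (card T))"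
      using x G N0 B[of "Suc (card T)"] by (subst (asm) ennreal_inj) auto
    then have "x = G * N (Suc (card T)) / B (Suc (card T))"
      using B[of "Suc (card T)"] by (simp add: eq_divide_eq)
    then show ?thesis using x by simp
  qed
  define a where "a q = p * (p - 1) ^ q * t ^ Suc q / Suc q * (G * N (Suc q) / B (Suc q))" for q
  have a0: "0 \<le> a q" for q
    using p t G N0 B[of "Suc q"] by (auto simp: a_def intro!: mult_nonneg_nonneg divide_nonneg_pos)
  have "ennreal (G * (measure lebesgue (lp_parallel p t :: (real^'n) set) - measure lebesgue (lp_ball p :: (real^'n) set)))
     = (\<Sum>i\<in>UNIV. \<Sum>T\<in>Pow (UNIV - {i :: 'n}). ennreal (a (card T)))"
    unfolding G_def parallel_volume_moments[OF p t]
  proof (intro sum.cong refl)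
    fix i :: 'n and T assume "T \<in> Pow (UNIV - {i})"
    then show "ennreal (p * (p - 1) ^ card T * t ^ Suc (card T) / Suc (card T)) * lp_moment p i T = ennreal (a (card T))"
      unfolding a_def using p t
      by (subst mom, simp, subst ennreal_mult'[symmetric]) (auto intro!: mult_nonneg_nonneg divide_nonneg_nonneg simp del: of_nat_Suc power_Suc)
  qed
  also have "\<dots> = ennreal (\<Sum>i\<in>UNIV. \<Sum>T\<in>Pow (UNIV - {i :: 'n}). a (card T))"
    using a0 by (simp add: sum_nonneg)
  also have "(\<Sum>i\<in>UNIV. \<Sum>T\<in>Pow (UNIV - {i :: 'n}). a (card T)) = (\<Sum>i\<in>(UNIV :: 'n set). \<Sum>q\<le>?n - 1. real ((?n - 1) choose q) * a q)"
    by (intro sum.cong refl) (simp add: sum_Pow_card card_Diff_singleton)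
  also have "\<dots> = (\<Sum>q\<le>?n - 1. real ?n * (real ((?n - 1) choose q) * a q))"
    by (simp add: sum_distrib_left)
  also have "\<dots> = (\<Sum>q\<le>?n - 1. G * (p * (p - 1) ^ q * real (?n choose Suc q) / B (Suc q) * N (Suc q) * t ^ Suc q))"
  proof (rule sum.cong[OF refl])
    fix q
    \<comment> \<open>The absorption identity: the denominator \<open>Suc q\<close> left by the
      \<open>\<tau>\<close>-integral combines with the multiplicity into
      \<open>n choose Suc q\<close>.\<close>
    have "Suc q * (?n choose Suc q) = ?n * ((?n - 1) choose q)"
      using Suc_times_binomial[of q "?n - 1"] n0 by simp
    then have "real (Suc q) * real (?n choose Suc q) = real ?n * real ((?n - 1) choose q)"
      by (metis of_nat_mult)
    then have e: "real ?n * real ((?n - 1) choose q) / real (Suc q) = real (?n choose Suc q)"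
      by (simp add: field_simps)
    have "real ?n * (real ((?n - 1) choose q) * a q)
       = G * (p * (p - 1) ^ q * (real ?n * real ((?n - 1) choose q) / real (Suc q)) / B (Suc q) * N (Suc q) * t ^ Suc q)"
      unfolding a_def by (simp add: mult_ac del: of_nat_Suc power_Suc)
    then show "real ?n * (real ((?n - 1) choose q) * a q) = G * (p * (p - 1) ^ q * real (?n choose Suc q) / B (Suc q) * N (Suc q) * t ^ Suc q)"
      unfolding e .
  qed
  also have "\<dots> = G * (\<Sum>q\<le>?n - 1. p * (p - 1) ^ q * real (?n choose Suc q) / B (Suc q) * N (Suc q) * t ^ Suc q)"
    by (simp only: sum_distrib_left)
  also have "(\<Sum>q\<le>?n - 1. p * (p - 1) ^ q * real (?n choose Suc q) / B (Suc q) * N (Suc q) * t ^ Suc q)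
     = (\<Sum>m=1..?n. p * (p - 1) ^ (m - 1) * real (?n choose m) / B m * N m * t ^ m)"
  proof (rule sum.reindex_bij_witness[of _ "\<lambda>m. m - 1" Suc])
    show "Suc q \<in> {1..?n}" if "q \<in> {..?n - 1}" for q
      using that n0 unfolding atMost_iff atLeastAtMost_iff by linarith
  qed auto
  finally have eq: "ennreal (G * (measure lebesgue (lp_parallel p t :: (real^'n) set) - measure lebesgue (lp_ball p :: (real^'n) set)))
     = ennreal (G * (\<Sum>m=1..?n. p * (p - 1) ^ (m - 1) * real (?n choose m) / B m * N m * t ^ m))" .
  \<comment> \<open>Cancelling \<open>ennreal\<close> requires both sides to be nonnegative, because
    negative reals are sent to \<open>0\<close>.\<close>
  have mono: "measure lebesgue (lp_ball p :: (real^'n) set) \<le> measure lebesgue (lp_parallel p t :: (real^'n) set)"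
    using p by (intro measure_mono_fmeasurable lp_ball_subset_parallel fmeasurableD lmeasurable_compact compact_lp_ball compact_lp_parallel) auto
  have "0 \<le> (\<Sum>m=1..?n. p * (p - 1) ^ (m - 1) * real (?n choose m) / B m * N m * t ^ m)"
    using p t N0 B by (intro sum_nonneg mult_nonneg_nonneg divide_nonneg_pos) auto
  then have "measure lebesgue (lp_parallel p t :: (real^'n) set) - measure lebesgue (lp_ball p :: (real^'n) set)
     = (\<Sum>m=1..?n. p * (p - 1) ^ (m - 1) * real (?n choose m) / B m * N m * t ^ m)"
    using eq G mono by (subst (asm) ennreal_inj) auto
  then show ?thesis by (simp add: B_def N_def)
qed

text \<open>Comparison of coefficients in \<open>parallel_volume_polynomial\<close> under
  \<open>m = n - j\<close>: the factor \<open>unit_ball_vol\<close> required by the Steiner formula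
  is divided out. The case \<open>j = n\<close> is the constant term, the volume itself, as the ball
  of dimension \<open>0\<close> has volume \<open>1\<close>.\<close>

lemma steiner_coeffs_lp_ball:
  assumes p: "1 < p"
  shows "steiner_coeffs (lp_ball p :: (real^'n::finite) set)
    (\<lambda>j. if j = CARD('n) then measure lebesgue (lp_ball p :: (real^'n) set)
      else p * (p - 1) ^ (CARD('n) - j - 1) * real (CARD('n) choose j)
        / (unit_ball_vol (real (CARD('n) - j)) * Gamma (1 + real j / p) * Gamma (real (CARD('n) - j) / 2))
        * (LBINT \<theta>:{0..}. lp_integrand p CARD('n) (CARD('n) - j) \<theta>))"
  (is "steiner_coeffs _ ?V")
  unfolding steiner_coeffs_def lp_parallel_def[symmetric]
proof (intro allI impI)
  fix t :: real assume t: "0 \<le> t"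
  let ?n = "CARD('n)"
  have "(\<Sum>j\<le>?n. unit_ball_vol (real (?n - j)) * ?V j * t ^ (?n - j))
     = unit_ball_vol (real (?n - ?n)) * ?V ?n * t ^ (?n - ?n) + (\<Sum>j<?n. unit_ball_vol (real (?n - j)) * ?V j * t ^ (?n - j))"
    by (simp add: lessThan_Suc_atMost[symmetric])
  also have "(\<Sum>j<?n. unit_ball_vol (real (?n - j)) * ?V j * t ^ (?n - j))
     = (\<Sum>m=1..?n. p * (p - 1) ^ (m - 1) * real (?n choose m) /
        (Gamma (1 + real (?n - m) / p) * Gamma (real m / 2)) * (LBINT \<theta>:{0..}. lp_integrand p ?n m \<theta>) * t ^ m)"
  proof (rule sum.reindex_bij_witness[of _ "\<lambda>m. ?n - m" "\<lambda>j. ?n - j"])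
    fix j assume "j \<in> {..<?n}"
    then have j: "j < ?n" by simp
    have "unit_ball_vol (real (?n - j)) \<noteq> 0" using unit_ball_vol_pos[of "real (?n - j)"] by linarith
    then show "p * (p - 1) ^ ((?n - j) - 1) * real (?n choose (?n - j)) /
        (Gamma (1 + real (?n - (?n - j)) / p) * Gamma (real (?n - j) / 2)) * (LBINT \<theta>:{0..}. lp_integrand p ?n (?n - j) \<theta>) * t ^ (?n - j)
      = unit_ball_vol (real (?n - j)) * ?V j * t ^ (?n - j)"
      using j binomial_symmetric[of j ?n] by (simp del: of_nat_diff)
  qed auto
  finally show "measure lebesgue (lp_parallel p t :: (real^'n) set) = (\<Sum>j\<le>DIM(real^'n). unit_ball_vol (real (DIM(real^'n) - j)) * ?V j * t ^ (DIM(real^'n) - j))"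
    unfolding parallel_volume_polynomial[OF p t] by simp
qed

theorem theorem2p1:
  fixes p :: real
  assumes "1 < p" and "CARD('n::finite) \<ge> 2"
  shows "(\<forall>\<theta>\<ge>0. integrable lborel (lp_weight p \<theta>)
            \<and> integrable lborel (\<lambda>x. \<bar>x\<bar> powr (p - 2) * lp_weight p \<theta> x)
            \<and> integrable lborel (\<lambda>x. \<bar>x\<bar> powr (2 * p - 2) * lp_weight p \<theta> x)
            \<and> (I_fun p has_real_derivative - K_fun p \<theta>) (at \<theta> within {0..}))
       \<and> (\<forall>j<CARD('n).
            set_integrable lborel {0..} (\<lambda>\<theta>. \<theta> powr (real (CARD('n) - j) / 2 - 1)
                * I_fun p \<theta> ^ j * J_fun p \<theta> ^ (CARD('n) - j - 1) * K_fun p \<theta>)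
            \<and> intrinsic_volume j (lp_ball p :: (real ^ 'n) set) =
                p * (p - 1) ^ (CARD('n) - j - 1) * real (CARD('n) choose j)
                  / (unit_ball_vol (real (CARD('n) - j)) * Gamma (1 + real j / p)
                       * Gamma (real (CARD('n) - j) / 2))
                * (LBINT \<theta>:{0..}. \<theta> powr (real (CARD('n) - j) / 2 - 1)
                     * I_fun p \<theta> ^ j * J_fun p \<theta> ^ (CARD('n) - j - 1) * K_fun p \<theta>))"
proof (intro conjI allI impI)
  note p = \<open>1 < p\<close>
  fix \<theta> :: real assume \<theta>: "0 \<le> \<theta>"
  show "integrable lborel (lp_weight p \<theta>)" by (rule integrable_lp_weight[OF p \<theta>])
  show "integrable lborel (\<lambda>x. \<bar>x\<bar> powr (p - 2) * lp_weight p \<theta> x)"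
    "integrable lborel (\<lambda>x. \<bar>x\<bar> powr (2 * p - 2) * lp_weight p \<theta> x)"
    using p by (auto intro!: integrable_powr_lp_weight[OF p _ \<theta>])
  show "(I_fun p has_real_derivative - K_fun p \<theta>) (at \<theta> within {0..})"
    by (rule I_fun_has_derivative[OF p \<theta>])
next
  note p = \<open>1 < p\<close>
  fix j assume j: "j < CARD('n)"
  have e: "lp_integrand p CARD('n) (CARD('n) - j) = (\<lambda>\<theta>. \<theta> powr (real (CARD('n) - j) / 2 - 1)
                * I_fun p \<theta> ^ j * J_fun p \<theta> ^ (CARD('n) - j - 1) * K_fun p \<theta>)"
    using j by (simp add: lp_integrand_def fun_eq_iff)
  show "set_integrable lborel {0..} (\<lambda>\<theta>. \<theta> powr (real (CARD('n) - j) / 2 - 1)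
                * I_fun p \<theta> ^ j * J_fun p \<theta> ^ (CARD('n) - j - 1) * K_fun p \<theta>)"
    unfolding e[symmetric] by (rule lp_integrand_integral(1)[OF p]) (use j in auto)
  show "intrinsic_volume j (lp_ball p :: (real ^ 'n) set) =
                p * (p - 1) ^ (CARD('n) - j - 1) * real (CARD('n) choose j)
                  / (unit_ball_vol (real (CARD('n) - j)) * Gamma (1 + real j / p)
                       * Gamma (real (CARD('n) - j) / 2))
                * (LBINT \<theta>:{0..}. \<theta> powr (real (CARD('n) - j) / 2 - 1)
                     * I_fun p \<theta> ^ j * J_fun p \<theta> ^ (CARD('n) - j - 1) * K_fun p \<theta>)"
    unfolding e[symmetric]
    using intrinsic_volume_eqI[OF steiner_coeffs_lp_ball[OF p, where 'n = 'n], of j] j by simp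
qed

end
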